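(* The Shintani zeta function associated to the $\mathrm{PVS}$ of $2\times 2 \times 2$-cubes is given by: \begin{align*} Z_{\rm{Shintani}}(s_1, s_2, w) &= \sum_{ A \in \left( B'_2(\mathbb{Z}) \times B'_2(\mathbb{Z}) \times \mathrm{SL}_2(\mathbb{Z}) \right) \backslash V^{ss}_{\mathbb{Z}}} \frac{1}{|D(A)|^w |m(A)|^{s_1} |n(A)|^{s_2}} \\ & =\sum_{D = D_0 D_1^2\neq 0} \frac{1}{|D|^w} \sum_{m, n > 0} \frac{B(D, m,n)}{m^{s_1}n^{s_2}}, \end{align*} where $$B(D, m, n) =\sum_{\substack{d|D_1 \\ d|m,\ d|n}} d \cdot A(D/ d^2, 4m/d) \cdot A(D/d^2, 4n/d).$$
   Context: Let $V_{\mathbb{Z}} = \mathbb{Z}^2 \otimes \mathbb{Z}^2 \otimes \mathbb{Z}^2$ be the set of $2\times2\times2$ integer cubes, written $A = \left( \left( \begin{matrix} a & b \\ c & d \end{matrix} \right), \left( \begin{matrix} e & f \\ g & h \end{matrix} \right) \right)$. Write $M_1=\left(\begin{smallmatrix} a&b\\ c&d\end{smallmatrix}\right)$, $N_1=\left(\begin{smallmatrix} e&f\\ g&h\end{smallmatrix}\right)$; $M_2=\left(\begin{smallmatrix} a&c\\ e&g\end{smallmatrix}\right)$, $N_2=\left(\begin{smallmatrix} b&d\\ f&h\end{smallmatrix}\right)$; $M_3=\left(\begin{smallmatrix} a&e\\ b&f\end{smallmatrix}\right)$, $N_3=\left(\begin{smallmatrix} c&g\\ d&h\end{smallmatrix}\right)$.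 An element $(g_1,g_2,g_3)$ of $\mathrm{GL}_2\times\mathrm{GL}_2\times\mathrm{GL}_2$ acts by letting $g_i=\left(\begin{smallmatrix} g_{11}&g_{12}\\ g_{21}&g_{22}\end{smallmatrix}\right)$ send the pair $(M_i,N_i)$ to $(g_{11}M_i+g_{12}N_i,\ g_{21}M_i+g_{22}N_i)$. $B'_2(\mathbb{Z})$ is the subgroup of lower-triangular matrices in $\mathrm{SL}_2(\mathbb{Z})$ with positive diagonal entries. The relative invariants are $m(A) = ad- bc$, $n(A)= ag - ce$ and the discriminant $D(A) = (-ah+bg+cf-de)^2 - 4 (ad-bc)(eh-fg)$. $V^{ss}_{\mathbb{Z}}$ is the set of cubes on which none of $D(A),m(A),n(A)$ vanishes. $A(d, a)$ denotes the number of solutions to the congruence $x^2 \equiv d \ (\text{mod} \ a)$. For $D\neq0$ write $D=D_0D_1^2$ with $D_0$ square-free. *)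

theory Defs
  imports
    "HOL-Analysis.Analysis"
    "HOL-Number_Theory.Cong"
    "HOL-Computational_Algebra.Squarefree"
    "HOL-Algebra.Group_Action"
begin

section \<open>Integer cubes and the group action\<close>

text \<open>\<open>Cube a b c d e f g h\<close> is the cube with front face \<open>(a, b; c, d)\<close> and back face
  \<open>(e, f; g, h)\<close>.\<close>

datatype cube = Cube int int int int int int int int

definition mat2 :: "'a::zero \<Rightarrow> 'a \<Rightarrow> 'a \<Rightarrow> 'a \<Rightarrow> 'a^2^2" where
  "mat2 p q r s = vector [vector [p, q], vector [r, s]]"

text \<open>The three ways \<open>(M\<^sub>i, N\<^sub>i)\<close> of slicing a cube into a pair of matrices, with their
  inverses.\<close>

fun slice1 :: "cube \<Rightarrow> (int^2^2) \<times> (int^2^2)" where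
  "slice1 (Cube a b c d e f g h) = (mat2 a b c d, mat2 e f g h)"

fun slice2 :: "cube \<Rightarrow> (int^2^2) \<times> (int^2^2)" where
  "slice2 (Cube a b c d e f g h) = (mat2 a c e g, mat2 b d f h)"

fun slice3 :: "cube \<Rightarrow> (int^2^2) \<times> (int^2^2)" where
  "slice3 (Cube a b c d e f g h) = (mat2 a e b f, mat2 c g d h)"

fun glue1 :: "(int^2^2) \<times> (int^2^2) \<Rightarrow> cube" where
  "glue1 (M, N) = Cube (M$1$1) (M$1$2) (M$2$1) (M$2$2) (N$1$1) (N$1$2) (N$2$1) (N$2$2)"

fun glue2 :: "(int^2^2) \<times> (int^2^2) \<Rightarrow> cube" where
  "glue2 (M, N) = Cube (M$1$1) (N$1$1) (M$1$2) (N$1$2) (M$2$1) (N$2$1) (M$2$2) (N$2$2)"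

fun glue3 :: "(int^2^2) \<times> (int^2^2) \<Rightarrow> cube" where
  "glue3 (M, N) = Cube (M$1$1) (M$2$1) (N$1$1) (N$2$1) (M$1$2) (M$2$2) (N$1$2) (N$2$2)"

lemma mat2_nth [simp]:
  "mat2 p q r s $ 1 $ 1 = p" "mat2 p q r s $ 1 $ 2 = q"
  "mat2 p q r s $ 2 $ 1 = r" "mat2 p q r s $ 2 $ 2 = s"
  by (simp_all add: mat2_def)

lemma glue_slice [simp]:
  "glue1 (slice1 A) = A" "glue2 (slice2 A) = A" "glue3 (slice3 A) = A"
  by (cases A; simp)+

lemma slice_glue [simp]:
  "slice1 (glue1 P) = P" "slice2 (glue2 P) = P" "slice3 (glue3 P) = P"
  by (cases P; simp add: vec_eq_iff forall_2)+

text \<open>\<open>g\<close> sends \<open>(M, N)\<close> to \<open>(g\<^sub>1\<^sub>1 M + g\<^sub>1\<^sub>2 N, g\<^sub>2\<^sub>1 M + g\<^sub>2\<^sub>2 N)\<close>.\<close>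

fun pair_act :: "int^2^2 \<Rightarrow> (int^2^2) \<times> (int^2^2) \<Rightarrow> (int^2^2) \<times> (int^2^2)" where
  "pair_act g (M, N) =
     ((\<chi> i j. g$1$1 * M$i$j + g$1$2 * N$i$j), (\<chi> i j. g$2$1 * M$i$j + g$2$2 * N$i$j))"

fun cube_act :: "(int^2^2) \<times> (int^2^2) \<times> (int^2^2) \<Rightarrow> cube \<Rightarrow> cube" where
  "cube_act (g1, g2, g3) A =
     glue1 (pair_act g1 (slice1 (glue2 (pair_act g2 (slice2 (glue3 (pair_act g3 (slice3 A))))))))"

definition SL2Z :: "(int^2^2) monoid" where
  "SL2Z = \<lparr>carrier = {g. det g = 1}, mult = (**), one = mat 1\<rparr>"

definition B2Z :: "(int^2^2) monoid" where
  "B2Z = SL2Z \<lparr>carrier := {g \<in> carrier SL2Z. g$1$2 = 0 \<and> g$1$1 > 0 \<and> g$2$2 > 0}\<rparr>"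

definition cube_group :: "((int^2^2) \<times> (int^2^2) \<times> (int^2^2)) monoid" where
  "cube_group = B2Z \<times>\<times> B2Z \<times>\<times> SL2Z"


section \<open>Relative invariants and orbits\<close>

fun cube_m :: "cube \<Rightarrow> int" where
  "cube_m (Cube a b c d e f g h) = a*d - b*c"

fun cube_n :: "cube \<Rightarrow> int" where
  "cube_n (Cube a b c d e f g h) = a*g - c*e"

fun cube_disc :: "cube \<Rightarrow> int" where
  "cube_disc (Cube a b c d e f g h) =
     (- a*h + b*g + c*f - d*e)\<^sup>2 - 4 * (a*d - b*c) * (e*h - f*g)"

definition ss_cubes :: "cube set" where
  "ss_cubes = {A. cube_disc A \<noteq> 0 \<and> cube_m A \<noteq> 0 \<and> cube_n A \<noteq> 0}"

definition ss_orbits :: "cube set set" where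
  "ss_orbits = orbits cube_group ss_cubes (\<lambda>g. restrict (cube_act g) ss_cubes)"

lemma SL2Z_iff: "g \<in> carrier SL2Z \<longleftrightarrow> g$1$1 * g$2$2 - g$1$2 * g$2$1 = 1"
  by (simp add: SL2Z_def det_2)

lemma B2Z_iff:
  "g \<in> carrier B2Z \<longleftrightarrow> g$1$1 = 1 \<and> g$1$2 = 0 \<and> g$2$2 = 1"
  by (auto simp: B2Z_def SL2Z_iff zmult_eq_1_iff)

lemma cube_act_invariants:
  assumes "g \<in> carrier cube_group"
  shows "cube_m (cube_act g A) = cube_m A"
    and "cube_n (cube_act g A) = cube_n A"
    and "cube_disc (cube_act g A) = cube_disc A"
proof -
  obtain g1 g2 g3 where g: "g = (g1, g2, g3)" by (cases g)
  have g12: "g1$1$1 = 1" "g1$1$2 = 0" "g1$2$2 = 1" "g2$1$1 = 1" "g2$1$2 = 0" "g2$2$2 = 1"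
    and g3: "g3$1$1 * g3$2$2 - g3$1$2 * g3$2$1 = 1"
    using assms by (auto simp: cube_group_def g B2Z_iff SL2Z_iff)
  obtain a b c d e f g' h where A: "A = Cube a b c d e f g' h" by (cases A)
  show "cube_m (cube_act g A) = cube_m A"
    using g3 by (simp add: A g g12) algebra
  show "cube_n (cube_act g A) = cube_n A"
    using g3 by (simp add: A g g12) algebra
  show "cube_disc (cube_act g A) = cube_disc A"
    using g3 by (simp add: A g g12) algebra
qed


lemma pair_act_mult: "pair_act (g ** h) P = pair_act g (pair_act h P)"
  by (cases P) (simp add: matrix_matrix_mult_def sum_2 vec_eq_iff forall_2 algebra_simps)

lemma pair_act_one: "pair_act (mat 1) P = P"
  by (cases P) (simp add: mat_def vec_eq_iff)

lemma act12: "glue1 (pair_act g (slice1 (glue2 (pair_act h (slice2 A))))) =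
    glue2 (pair_act h (slice2 (glue1 (pair_act g (slice1 A)))))"
  by (cases A) (simp add: algebra_simps)

lemma act13: "glue1 (pair_act g (slice1 (glue3 (pair_act h (slice3 A))))) =
    glue3 (pair_act h (slice3 (glue1 (pair_act g (slice1 A)))))"
  by (cases A) (simp add: algebra_simps)

lemma act23: "glue2 (pair_act g (slice2 (glue3 (pair_act h (slice3 A))))) =
    glue3 (pair_act h (slice3 (glue2 (pair_act g (slice2 A)))))"
  by (cases A) (simp add: algebra_simps)

lemma cube_act_mult:
  "cube_act (g \<otimes>\<^bsub>cube_group\<^esub> h) A = cube_act g (cube_act h A)"
  by (cases g; cases h)
    (simp add: cube_group_def B2Z_def SL2Z_def DirProd_def flip: pair_act_mult act12 act13 act23)

lemma cube_act_one: "cube_act \<one>\<^bsub>cube_group\<^esub> A = A"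
  by (simp add: cube_group_def B2Z_def SL2Z_def DirProd_def pair_act_one)

lemma group_SL2Z: "group SL2Z"
proof (rule groupI)
  fix g assume "g \<in> carrier SL2Z"
  then have d: "g$1$1 * g$2$2 - g$1$2 * g$2$1 = 1" by (simp add: SL2Z_iff)
  let ?h = "mat2 (g$2$2) (- g$1$2) (- g$2$1) (g$1$1)"
  have "?h ** g = mat 1"
    using d by (simp add: matrix_matrix_mult_def mat_def sum_2 vec_eq_iff forall_2 algebra_simps)
  moreover have "?h \<in> carrier SL2Z"
    using d by (simp add: SL2Z_iff algebra_simps)
  ultimately show "\<exists>h\<in>carrier SL2Z. h \<otimes>\<^bsub>SL2Z\<^esub> g = \<one>\<^bsub>SL2Z\<^esub>"
    by (auto simp: SL2Z_def)
qed (auto simp: SL2Z_def det_mul matrix_mul_assoc)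

lemma group_B2Z: "group B2Z"
proof (rule groupI)
  fix g assume g: "g \<in> carrier B2Z"
  let ?h = "mat2 1 0 (- g$2$1) 1"
  have "?h ** g = mat 1"
    using g by (simp add: B2Z_iff matrix_matrix_mult_def mat_def sum_2 vec_eq_iff forall_2)
  moreover have "?h \<in> carrier B2Z" by (simp add: B2Z_iff)
  ultimately show "\<exists>h\<in>carrier B2Z. h \<otimes>\<^bsub>B2Z\<^esub> g = \<one>\<^bsub>B2Z\<^esub>"
    by (auto simp: B2Z_def SL2Z_def)
next
  fix g h assume "g \<in> carrier B2Z" "h \<in> carrier B2Z"
  moreover have "g \<otimes>\<^bsub>B2Z\<^esub> h = g ** h" by (simp add: B2Z_def SL2Z_def)
  ultimately show "g \<otimes>\<^bsub>B2Z\<^esub> h \<in> carrier B2Z"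
    by (simp add: B2Z_iff matrix_matrix_mult_def sum_2)
next
  have "\<one>\<^bsub>B2Z\<^esub> = mat 1" by (simp add: B2Z_def SL2Z_def)
  then show "\<one>\<^bsub>B2Z\<^esub> \<in> carrier B2Z" by (simp add: B2Z_iff mat_def)
qed (auto simp: B2Z_def SL2Z_def matrix_mul_assoc)

lemma group_cube_group: "group cube_group"
  unfolding cube_group_def by (intro DirProd_group group_SL2Z group_B2Z)

lemma group_action_cube_act:
  "group_action cube_group ss_cubes (\<lambda>g. restrict (cube_act g) ss_cubes)"
proof -
  interpret G: group cube_group by (rule group_cube_group)
  have stable: "cube_act g A \<in> ss_cubes" if "g \<in> carrier cube_group" "A \<in> ss_cubes" for g A
    using that by (simp add: ss_cubes_def cube_act_invariants)
  have inv: "cube_act (inv\<^bsub>cube_group\<^esub> g) (cube_act g A) = A"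
    "cube_act g (cube_act (inv\<^bsub>cube_group\<^esub> g) A) = A" if "g \<in> carrier cube_group" for g A
    using that by (simp_all flip: cube_act_mult add: cube_act_one)
  have bij: "restrict (cube_act g) ss_cubes \<in> Bij ss_cubes" if "g \<in> carrier cube_group" for g
    unfolding Bij_def using that
    by (auto intro!: bij_betw_byWitness[where f' = "cube_act (inv\<^bsub>cube_group\<^esub> g)"]
        simp: stable inv)
  show ?thesis
    unfolding group_action_def
  proof (rule group_hom.intro[OF group_cube_group group_BijGroup], unfold_locales, rule homI)
    fix g h assume gh: "g \<in> carrier cube_group" "h \<in> carrier cube_group"
    show "restrict (cube_act (g \<otimes>\<^bsub>cube_group\<^esub> h)) ss_cubes =
        restrict (cube_act g) ss_cubes \<otimes>\<^bsub>BijGroup ss_cubes\<^esub> restrict (cube_act h) ss_cubes"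
      using gh by (simp add: BijGroup_def bij compose_def)
        (simp add: restrict_def fun_eq_iff stable cube_act_mult)
  qed (simp add: BijGroup_def bij)
qed


section \<open>The two Dirichlet series\<close>

text \<open>By \<open>cube_act_invariants\<close> the value does not depend on the chosen representative.\<close>

definition orbit_term :: "complex \<Rightarrow> complex \<Rightarrow> complex \<Rightarrow> cube set \<Rightarrow> complex" where
  "orbit_term s1 s2 w X = (let A = (SOME A. A \<in> X) in
     1 / (of_int \<bar>cube_disc A\<bar> powr w * of_int \<bar>cube_m A\<bar> powr s1 * of_int \<bar>cube_n A\<bar> powr s2))"

definition Z_Shintani :: "complex \<Rightarrow> complex \<Rightarrow> complex \<Rightarrow> complex" where
  "Z_Shintani s1 s2 w = (\<Sum>\<^sub>\<infinity>X\<in>ss_orbits. orbit_term s1 s2 w X)"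

definition sqrt_count :: "int \<Rightarrow> nat \<Rightarrow> nat" where
  "sqrt_count d a = card {x \<in> {0..<int a}. [x\<^sup>2 = d] (mod int a)}"

text \<open>Here \<open>square_part D\<close> is the positive integer \<open>D\<^sub>1\<close> in \<open>D = D\<^sub>0 D\<^sub>1\<^sup>2\<close> with \<open>D\<^sub>0\<close>
  square-free, so all divisions are exact.\<close>

definition B_coeff :: "int \<Rightarrow> nat \<Rightarrow> nat \<Rightarrow> nat" where
  "B_coeff D m n =
     (\<Sum>d | int d dvd square_part D \<and> d dvd m \<and> d dvd n.
        d * sqrt_count (D div (int d)\<^sup>2) (4 * m div d) * sqrt_count (D div (int d)\<^sup>2) (4 * n div d))"

end

theory Submission
  imports Defs
begin

text \<open>View a cube as a \<open>2 \<times> 4\<close> integer matrix with rows \<open>(a, e, b, f)\<close> and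
  \<open>(c, g, d, h)\<close>; the third factor acts by row operations. Among its \<open>2 \<times> 2\<close> minors are \<open>m\<close> and
  \<open>n\<close>, and the Pluecker relation turns the remaining ones into integers \<open>\<beta>\<close>, \<open>\<gamma>\<close> with
  \<open>\<beta>\<^sup>2 \<equiv> D\<close> modulo \<open>4m\<close> and \<open>\<gamma>\<^sup>2 \<equiv> D\<close> modulo \<open>4n\<close>; the two triangular factors translate
  \<open>\<beta>\<close> by multiples of \<open>2m\<close> and \<open>\<gamma>\<close> by multiples of \<open>2n\<close>. After normalising the first column to
  \<open>(a, 0)\<close> with \<open>a > 0\<close>, let \<open>d\<close> be the content of the second row. Dividing that row by \<open>d\<close> divides all
  minors by \<open>d\<close> and leaves a cube determined by \<open>(D, m, n, \<beta>, \<gamma>)\<close> up to adding multiples of the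
  primitive second row to the first; in the original cube this multiple matters modulo \<open>d\<close>. Summing over
  the signs of \<open>m\<close> and \<open>n\<close> gives exactly \<open>B(D, m, n)\<close> orbits. Convergence follows from a bound for the
  number of roots that is uniform in \<open>D\<close>.\<close>

section \<open>Moves and orbits\<close>

text \<open>Minus the middle coefficient of the binary quadratic form
  \<open>det (x M1 + y N1)\<close>, whose leading coefficient is \<open>cube_m\<close>. Likewise
  \<open>cube_gamma\<close> is the middle coefficient of \<open>det (x M2 + y N2)\<close>, with
  leading coefficient \<open>cube_n\<close>. Both forms have discriminant
  \<open>cube_disc\<close>.\<close>

fun cube_beta :: "cube \<Rightarrow> int" where
  "cube_beta (Cube a b c d e f g h) = (b*g - d*e) - (a*h - c*f)"

fun cube_gamma :: "cube \<Rightarrow> int" where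
  "cube_gamma (Cube a b c d e f g h) = (b*g - d*e) + (a*h - c*f)"

lemma cube_disc_eq_beta:
  "cube_disc (Cube a b c d e f g h) =
     (cube_beta (Cube a b c d e f g h))\<^sup>2 - 4 * cube_m (Cube a b c d e f g h) * (e*h - f*g)"
  by (simp add: power2_eq_square algebra_simps)

lemma cube_disc_eq_gamma:
  "cube_disc (Cube a b c d e f g h) =
     (cube_gamma (Cube a b c d e f g h))\<^sup>2 - 4 * cube_n (Cube a b c d e f g h) * (b*h - d*f)"
  by (simp add: power2_eq_square algebra_simps)

text \<open>By \<open>B2Z_iff\<close> the triangular factors are unipotent, so a single integer
  describes each of them.\<close>

definition move :: "int \<Rightarrow> int \<Rightarrow> int^2^2 \<Rightarrow> (int^2^2) \<times> (int^2^2) \<times> (int^2^2)" where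
  "move u t S = (mat2 1 0 u 1, mat2 1 0 t 1, S)"

lemma move_in_cube_group: "det S = 1 \<Longrightarrow> move u t S \<in> carrier cube_group"
  by (simp add: move_def cube_group_def B2Z_iff SL2Z_def)

lemma cube_group_eq_move:
  assumes "g \<in> carrier cube_group"
  obtains u t S where "g = move u t S" "det S = 1"
proof -
  obtain g1 g2 S where g: "g = (g1, g2, S)" by (cases g)
  have "g1 = mat2 1 0 (g1$2$1) 1" "g2 = mat2 1 0 (g2$2$1) 1" "det S = 1"
    using assms by (auto simp: g cube_group_def B2Z_iff SL2Z_def vec_eq_iff forall_2)
  then show thesis
    using that[of "g1$2$1" "g2$2$1" S] by (simp add: g move_def)
qed

section \<open>Row operations and shears\<close>

lemma cube_act_rows:
  "cube_act (move 0 0 (mat2 p q r s)) (Cube a b c d e f g h) =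
     Cube (p*a + q*c) (p*b + q*d) (r*a + s * c) (r*b + s * d)
          (p*e + q*g) (p*f + q*h) (r*e + s * g) (r*f + s * h)"
  by (simp add: move_def)

lemma cube_act_shear:
  "cube_act (move u t (mat 1)) (Cube a b c d e f g h) =
     Cube a (b + t*a) c (d + t*c)
          (e + u*a) (f + t*e + u*b + u*t*a) (g + u*c) (h + t*g + u*d + u*t*c)"
  by (simp add: move_def mat_def algebra_simps)

text \<open>The three factors commute, so the shears, which alone change \<beta> and \<gamma>, can
  be carried out before the row operation.\<close>

lemma cube_act_move:
  "cube_act (move u t S) A = cube_act (move 0 0 S) (cube_act (move u t (mat 1)) A)"
proof -
  have 1: "mat2 1 0 0 1 = (mat 1 :: int^2^2)"
    by (simp add: vec_eq_iff forall_2 mat_def)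
  show ?thesis
    by (simp add: move_def pair_act_one 1 flip: act13 act23)
qed

text \<open>The parameter \<open>u\<close> substitutes \<open>(x + u*y, y)\<close> in
  \<open>det (x M1 + y N1)\<close>; the parameter \<open>t\<close> acts on both slices by the same
  unimodular column operation and leaves this form fixed.\<close>

lemma cube_beta_shear:
  "cube_beta (cube_act (move u t (mat 1)) A) = cube_beta A - 2 * u * cube_m A"
  by (cases A) (simp add: cube_act_shear algebra_simps)

lemma cube_gamma_shear:
  "cube_gamma (cube_act (move u t (mat 1)) A) = cube_gamma A + 2 * t * cube_n A"
  by (cases A) (simp add: cube_act_shear algebra_simps)

lemma mat2_eta: "S = mat2 (S$1$1) (S$1$2) (S$2$1) (S$2$2)"
  by (simp add: vec_eq_iff forall_2)

section \<open>Equivalence of cubes under the group\<close>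

definition cube_eqv :: "cube \<Rightarrow> cube \<Rightarrow> bool" where
  "cube_eqv A B \<longleftrightarrow> (\<exists>g\<in>carrier cube_group. cube_act g A = B)"

interpretation cube_group: group cube_group
  by (rule group_cube_group)

lemma cube_eqv_refl: "cube_eqv A A"
  unfolding cube_eqv_def using cube_act_one cube_group.one_closed by blast

lemma cube_eqv_sym: "cube_eqv A B \<Longrightarrow> cube_eqv B A"
  unfolding cube_eqv_def
  by (metis cube_act_mult cube_act_one cube_group.inv_closed cube_group.l_inv)

lemma cube_eqv_trans: "cube_eqv A B \<Longrightarrow> cube_eqv B C \<Longrightarrow> cube_eqv A C"
  unfolding cube_eqv_def by (metis cube_act_mult cube_group.m_closed)

lemma cube_eqv_rows: "p * s - q * r = 1 \<Longrightarrow>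
   cube_eqv (Cube a b c d e f g h) (Cube (p*a + q*c) (p*b + q*d) (r*a + s * c) (r*b + s * d)
          (p*e + q*g) (p*f + q*h) (r*e + s * g) (r*f + s * h))"
  unfolding cube_eqv_def
  by (rule bexI[of _ "move 0 0 (mat2 p q r s)"])
     (simp_all only: cube_act_rows, simp add: move_in_cube_group det_2)

lemma cube_eqv_shear: "cube_eqv A (cube_act (move u t (mat 1)) A)"
  unfolding cube_eqv_def by (intro bexI[of _ "move u t (mat 1)"] move_in_cube_group) simp_all

lemma cube_eqv_invariants:
  assumes "cube_eqv A B"
  shows "cube_m B = cube_m A" "cube_n B = cube_n A" "cube_disc B = cube_disc A"
  using assms cube_act_invariants unfolding cube_eqv_def by auto

definition cube_orbit :: "cube \<Rightarrow> cube set" where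
  "cube_orbit A = {B. cube_eqv A B}"

lemma cube_orbit_eq_iff: "cube_orbit A = cube_orbit B \<longleftrightarrow> cube_eqv A B"
  unfolding cube_orbit_def using cube_eqv_refl cube_eqv_sym cube_eqv_trans by blast

lemma ss_orbits_eq: "ss_orbits = cube_orbit ` ss_cubes"
proof -
  have "orbit cube_group (\<lambda>g. restrict (cube_act g) ss_cubes) A = cube_orbit A"
    if "A \<in> ss_cubes" for A
    unfolding orbit_def cube_orbit_def cube_eqv_def using that by (auto simp del: cube_act.simps)
  then show ?thesis
    unfolding ss_orbits_def orbits_def by (auto simp: image_iff)
qed

lemma some_in_cube_orbit: "cube_eqv A (SOME B. B \<in> cube_orbit A)"
  using someI[of "\<lambda>B. B \<in> cube_orbit A" A] cube_eqv_refl unfolding cube_orbit_def by simp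

section \<open>Primitive cubes\<close>

lemma bezout3:
  fixes x y z :: int
  obtains u v w where "u * x + v * y + w * z = gcd x (gcd y z)"
proof -
  obtain v w where 1: "v * y + w * z = gcd y z" using bezout_int by blast
  obtain u t where "u * x + t * gcd y z = gcd x (gcd y z)" using bezout_int by blast
  then have "u * x + (t * v) * y + (t * w) * z = gcd x (gcd y z)"
    by (simp add: algebra_simps flip: 1)
  then show thesis by (rule that)
qed

lemma gcd3_mult:
  fixes k x y z :: int
  assumes "k > 0"
  shows "gcd (k * x) (gcd (k * y) (k * z)) = k * gcd x (gcd y z)"
  using assms by (simp add: gcd_mult_left)

text \<open>The cross product of \<open>x\<close> and \<open>y\<close> vanishes; pairing
  \<open>x\<close> with a Bezout vector of the primitive \<open>y\<close> produces the integer
  multiplier.\<close>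

lemma parallel_to_primitive:
  fixes x1 x2 x3 y1 y2 y3 :: int
  assumes "gcd y1 (gcd y2 y3) = 1"
    and "x1 * y2 = x2 * y1" "x1 * y3 = x3 * y1" "x2 * y3 = x3 * y2"
  obtains k where "x1 = k * y1" "x2 = k * y2" "x3 = k * y3"
proof -
  obtain u v w where 1: "u * y1 + v * y2 + w * y3 = 1"
    using bezout3[of y1 y2 y3] assms(1) by metis
  let ?k = "u * x1 + v * x2 + w * x3"
  have "x1 = ?k * y1" "x2 = ?k * y2" "x3 = ?k * y3"
    using 1 assms(2-4) by algebra+
  then show thesis by (rule that)
qed

section \<open>Primitive cubes and their invariants\<close>

fun prim_cube :: "cube \<Rightarrow> bool" where
  "prim_cube (Cube a b c d e f g h) \<longleftrightarrow> a > 0 \<and> c = 0 \<and> gcd d (gcd g h) = 1"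

text \<open>The row operation \<open>(1, k; 0, l)\<close> on the \<open>2 \<times> 4\<close> matrix.
  Its determinant is \<open>l\<close>, so every minor is multiplied by \<open>l\<close>, whatever
  \<open>k\<close> is.\<close>

fun stretch :: "int \<Rightarrow> int \<Rightarrow> cube \<Rightarrow> cube" where
  "stretch k l (Cube a b c d e f g h) =
     Cube (a + k*c) (b + k*d) (l*c) (l*d) (e + k*g) (f + k*h) (l*g) (l*h)"

lemma stretch_stretch: "stretch k l (stretch j 1 A) = stretch (j + k) l A"
  by (cases A) (simp add: algebra_simps)

text \<open>Adding \<open>q\<close> times the second row, which has been scaled by \<open>l\<close>,
  to the first changes \<open>k\<close> by \<open>q * l\<close>; hence only \<open>k\<close> modulo
  \<open>l\<close> matters for the orbit.\<close>

lemma stretch_eqv: "cube_eqv (stretch k l A) (stretch (k + q * l) l A)"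
proof -
  obtain a b c d e f g h where A: "A = Cube a b c d e f g h" by (cases A)
  show ?thesis
    using cube_eqv_rows[of 1 1 q 0 "a + k*c" "b + k*d" "l*c" "l*d" "e + k*g" "f + k*h" "l*g" "l*h"]
    by (simp add: A algebra_simps)
qed

lemma stretch_invariants:
  "cube_m (stretch k l A) = l * cube_m A"
  "cube_n (stretch k l A) = l * cube_n A"
  "cube_beta (stretch k l A) = l * cube_beta A"
  "cube_gamma (stretch k l A) = l * cube_gamma A"
  "cube_disc (stretch k l A) = l\<^sup>2 * cube_disc A"
  by (cases A; simp add: algebra_simps power2_eq_square)+

text \<open>The minors through the first column are \<open>a\<close> times the primitive vector
  \<open>(d, g, h)\<close>, so they determine both. The other minors form the cross product of
  \<open>(b, e, f)\<close> with \<open>(d, g, h)\<close>, which fixes \<open>(b, e, f)\<close> up to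
  multiples of \<open>(d, g, h)\<close>.\<close>

lemma prim_cube_unique:
  assumes "prim_cube A" "prim_cube B" and nz: "cube_m A \<noteq> 0" "cube_n A \<noteq> 0"
    and inv: "cube_m B = cube_m A" "cube_n B = cube_n A" "cube_disc B = cube_disc A"
      "cube_beta B = cube_beta A" "cube_gamma B = cube_gamma A"
  obtains k where "B = stretch k 1 A"
proof -
  obtain a b c d e f g h where A: "A = Cube a b c d e f g h" by (cases A)
  obtain a' b' c' d' e' f' g' h' where B: "B = Cube a' b' c' d' e' f' g' h'" by (cases B)
  have c: "c = 0" "c' = 0" and pos: "a > 0" "a' > 0"
    and g1: "gcd d (gcd g h) = 1" and g2: "gcd d' (gcd g' h') = 1"
    using assms(1,2) by (auto simp: A B)
  have md: "a' * d' = a * d" and ng: "a' * g' = a * g" using inv by (simp_all add: A B c)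
  have "2 * (a' * h') = 2 * (a * h)" and p2: "2 * (b' * g' - d' * e') = 2 * (b * g - d * e)"
    using inv(4,5) by (simp_all add: A B c)
  then have ah: "a' * h' = a * h" and be: "b' * g' - d' * e' = b * g - d * e" by simp_all
  have "a' * gcd d' (gcd g' h') = a * gcd d (gcd g h)"
    by (simp only: gcd3_mult[OF pos(1), symmetric] gcd3_mult[OF pos(2), symmetric] md ng ah)
  then have aa: "a' = a" using pos g1 g2 by simp
  have d: "d' = d" and g: "g' = g" and h: "h' = h" using md ng ah pos by (simp_all add: aa)
  \<comment> \<open>The last coefficient of each form is recovered from its discriminant, since the
    leading coefficient is nonzero.\<close>
  have "4 * (a * d) * (e' * h - f' * g) = 4 * (a * d) * (e * h - f * g)"
    using inv(3) unfolding A B cube_disc_eq_beta inv(4)[unfolded A B] by (simp add: c aa d g h)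
  then have eh: "e' * h - f' * g = e * h - f * g" using nz by (simp add: A c)
  have "4 * (a * g) * (b' * h - d * f') = 4 * (a * g) * (b * h - d * f)"
    using inv(3) unfolding A B cube_disc_eq_gamma inv(5)[unfolded A B] by (simp add: c aa d g h)
  then have bh: "b' * h - d * f' = b * h - d * f" using nz by (simp add: A c)
  have "(b' - b) * g = (e' - e) * d" "(b' - b) * h = (f' - f) * d" "(e' - e) * h = (f' - f) * g"
    using be eh bh by (simp_all add: d g algebra_simps)
  then obtain k where "b' - b = k * d" "e' - e = k * g" "f' - f = k * h"
    by (rule parallel_to_primitive[OF g1])
  then have "b' = b + k * d" "e' = e + k * g" "f' = f + k * h" by simp_all
  then have "B = stretch k 1 A" by (simp add: A B c aa d g h)
  then show thesis by (rule that)
qed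

text \<open>With \<open>r = (d, g, h)\<close> and \<open>v = (b, e, f)\<close> the invariants prescribe the cross product
  \<open>v \<times> r = w\<close>; as \<open>w\<close> is orthogonal to \<open>r\<close>, a solution is \<open>v = x \<times> w\<close> for any \<open>x\<close> with \<open>x \<bullet> r = 1\<close>.\<close>

lemma prim_cube_exists:
  assumes nz: "m \<noteq> 0" "n \<noteq> 0"
    and beta: "[\<beta>\<^sup>2 = D] (mod 4 * m)" and gamma: "[\<gamma>\<^sup>2 = D] (mod 4 * n)"
  obtains A where "prim_cube A" "cube_m A = m" "cube_n A = n" "cube_disc A = D"
    "cube_beta A = \<beta>" "cube_gamma A = \<gamma>"
proof -
  obtain E where E: "\<beta>\<^sup>2 - D = 4 * m * E"
    using beta by (auto simp: cong_iff_dvd_diff)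
  obtain C where C: "\<gamma>\<^sup>2 - D = 4 * n * C"
    using gamma by (auto simp: cong_iff_dvd_diff)
  have "\<beta>\<^sup>2 - \<gamma>\<^sup>2 = 2 * (2 * (m * E - n * C))" using E C by (simp add: algebra_simps)
  then have "even (\<beta>\<^sup>2 - \<gamma>\<^sup>2)" by simp
  then have "even (\<gamma> - \<beta>)" by simp
  \<comment> \<open>The prospective minors are \<open>\<eta> = a*h\<close>,
    \<open>\<rho> = b*g - d*e\<close>, \<open>E = e*h - f*g\<close> and
    \<open>C = b*h - d*f\<close>. The identity
    \<open>\<gamma>\<^sup>2 - \<beta>\<^sup>2 = 4 * \<eta> * \<rho>\<close> then yields the Pluecker
    relation.\<close>
  then obtain \<eta> where \<eta>: "\<gamma> = \<beta> + 2 * \<eta>" by (metis dvdE add_diff_cancel_left' diff_add_cancel add.commute)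
  define \<rho> where "\<rho> = \<beta> + \<eta>"
  have plucker: "m * E - n * C + \<eta> * \<rho> = 0"
    using E C unfolding \<eta> \<rho>_def by algebra
  define a where "a = gcd m (gcd n \<eta>)"
  have a: "a > 0" using nz by (simp add: a_def)
  have "a dvd m" "a dvd n" "a dvd \<eta>" by (auto simp: a_def intro: dvd_trans)
  then obtain d g h where dgh: "m = a * d" "n = a * g" "\<eta> = a * h" by (auto elim!: dvdE)
  have "a * gcd d (gcd g h) = gcd m (gcd n \<eta>)"
    by (simp only: gcd3_mult[OF a] dgh)
  then have prim: "gcd d (gcd g h) = 1" using a by (simp flip: a_def)
  have "a * (d * E - g * C + h * \<rho>) = 0" using plucker unfolding dgh by (simp add: algebra_simps)
  then have ort: "d * E - g * C + h * \<rho> = 0" using a by simp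
  obtain x y z where xyz: "x * d + y * g + z * h = 1"
    using bezout3[of d g h] prim by metis
  define b e f where bef: "b = y * \<rho> + z * C" "e = z * E - x * \<rho>" "f = - x * C - y * E"
  have w: "e * h - f * g = E" "b * h - d * f = C" "b * g - d * e = \<rho>"
    using ort xyz unfolding bef by algebra+
  let ?A = "Cube a b 0 d e f g h"
  have m: "cube_m ?A = m" and n: "cube_n ?A = n" by (simp_all add: dgh)
  have be: "cube_beta ?A = \<beta>" and ga: "cube_gamma ?A = \<gamma>"
    using w(3) by (simp_all add: \<eta> \<rho>_def flip: dgh)
  have "cube_disc ?A = D"
    unfolding cube_disc_eq_beta m be w using E by simp
  with m n be ga a prim show thesis by (intro that[of ?A]) simp_all
qed

section \<open>Reduction to stretched primitive cubes\<close>

lemma stretch_prim_cube: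
  assumes "a > 0" "cube_m (Cube a b 0 d e f g h) \<noteq> 0"
  obtains A where "prim_cube A" "gcd d (gcd g h) > 0"
    "Cube a b 0 d e f g h = stretch 0 (gcd d (gcd g h)) A"
proof -
  let ?l = "gcd d (gcd g h)"
  have l: "?l > 0" using assms by simp
  have "?l dvd d" "?l dvd g" "?l dvd h" by (auto intro: dvd_trans)
  then obtain d' g' h' where *: "d = ?l * d'" "g = ?l * g'" "h = ?l * h'" by (metis dvdE)
  have "?l * gcd d' (gcd g' h') = ?l * 1"
    unfolding gcd3_mult[OF l, symmetric] *[symmetric] by simp
  then have "gcd d' (gcd g' h') = 1" using l by (metis mult_cancel_left less_irrefl)
  then have "prim_cube (Cube a b 0 d' e f g' h')" using assms by simp
  moreover have "Cube a b 0 d e f g h = stretch 0 ?l (Cube a b 0 d' e f g' h')"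
    using * by simp
  ultimately show thesis using l by (intro that)
qed

text \<open>Bezout coefficients of the first column \<open>(a, c)\<close>, nonzero because
  \<open>m\<close> is, complete \<open>(- c', a')\<close> to a unimodular row operation that clears
  \<open>c\<close>.\<close>

lemma cube_eqv_first_column:
  assumes "cube_m A \<noteq> 0"
  obtains a b d e f g h where "a > 0" "cube_eqv A (Cube a b 0 d e f g h)"
proof -
  obtain a b c d e f g h where A: "A = Cube a b c d e f g h" by (cases A)
  define l where "l = gcd a c"
  have l: "l > 0" using assms by (auto simp: A l_def)
  obtain p q where pq: "p * a + q * c = l" unfolding l_def using bezout_int by blast
  obtain a' c' where ac: "a = l * a'" "c = l * c'" unfolding l_def by (metis dvdE gcd_dvd1 gcd_dvd2)
  have "l * (p * a' + q * c') = p * (l * a') + q * (l * c')" by (simp add: algebra_simps)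
  also have "\<dots> = l * 1" using pq by (simp flip: ac)
  finally have "l * (p * a' + q * c') = l * 1" .
  then have det: "p * a' - q * (- c') = 1" using l by simp
  have "- c' * a + a' * c = 0" using ac by algebra
  with cube_eqv_rows[OF det, of a b c d e f g h] pq l show thesis
    by (intro that[of l]) (simp_all add: A)
qed

lemma cube_act_shear_stretch:
  "cube_act (move u t (mat 1)) (stretch k l A) = stretch k l (cube_act (move u t (mat 1)) A)"
  by (cases A) (simp only: stretch.simps cube_act_shear, simp add: algebra_simps)

lemma cube_act_shear_0: "cube_act (move 0 0 (mat 1)) A = A"
  by (cases A) (simp only: cube_act_shear, simp)

text \<open>As \<open>c = 0\<close>, a shear fixes \<open>d\<close> and \<open>g\<close> and changes
  \<open>h\<close> by a combination of them, which preserves the gcd.\<close>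

lemma prim_cube_shear:
  assumes "prim_cube A"
  shows "prim_cube (cube_act (move u t (mat 1)) A)"
proof -
  obtain a b c d e f g h where A: "A = Cube a b c d e f g h" by (cases A)
  define j where "j = gcd d (gcd g (h + t * g + u * d))"
  have "j dvd d" "j dvd g" "j dvd h + t * g + u * d"
    unfolding j_def by (auto intro: dvd_trans)
  moreover from this have "j dvd h + t * g + u * d - t * g - u * d"
    by (intro dvd_diff dvd_mult)
  ultimately have "j dvd gcd d (gcd g h)" by (intro gcd_greatest) simp_all
  then have "j dvd 1" using assms unfolding A prim_cube.simps by metis
  moreover have "j \<ge> 0" by (simp add: j_def)
  ultimately have "j = 1" by simp
  then show ?thesis
    using assms unfolding A cube_act_shear by (simp add: j_def)
qed

text \<open>Both first columns have the form (positive, 0), which forces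
  \<open>S = (1, q; 0, 1)\<close>. The second row is then unchanged, so its content \<open>l\<close>
  agrees, and only \<open>k\<close> moves.\<close>

lemma stretch_prim_rows:
  assumes "prim_cube A" "prim_cube B" "l > 0" "l' > 0" "det S = 1"
    and eq: "cube_act (move 0 0 S) (stretch k l A) = stretch k' l' B"
  obtains q where "l' = l" "stretch k' l B = stretch (k + q * l) l A"
proof -
  obtain a b c d e f g h where A: "A = Cube a b c d e f g h" by (cases A)
  obtain a' b' c' d' e' f' g' h' where B: "B = Cube a' b' c' d' e' f' g' h'" by (cases B)
  obtain p q r s where S: "S = mat2 p q r s" using mat2_eta by blast
  have c: "c = 0" "c' = 0" and pos: "a > 0" "a' > 0"
    and g1: "gcd d (gcd g h) = 1" and g2: "gcd d' (gcd g' h') = 1"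
    using assms(1,2) by (auto simp: A B)
  have det: "p * s - q * r = 1" using \<open>det S = 1\<close> by (simp add: S det_2)
  note eqs = eq[unfolded A B S stretch.simps cube_act_rows c cube.inject]
  have "r * a = 0" "p * a = a'" using eqs by simp_all
  then have r: "r = 0" and "p > 0" using pos by (auto simp: zero_less_mult_iff)
  then have p: "p = 1" and s: "s = 1" using det by (auto simp: zmult_eq_1_iff)
  have "l' * d' = l * d" "l' * g' = l * g" "l' * h' = l * h"
    using eqs by (simp_all add: r s)
  then have "l' * gcd d' (gcd g' h') = l * gcd d (gcd g h)"
    by (simp only: gcd3_mult[OF assms(3), symmetric] gcd3_mult[OF assms(4), symmetric])
  then have l: "l' = l" using g1 g2 by simp
  have "stretch k' l B = stretch (k + q * l) l A"
    using eq unfolding A B S stretch.simps cube_act_rows c by (auto simp: p r s l algebra_simps)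
  with l show thesis by (rule that)
qed

lemma stretch_inject:
  assumes "prim_cube A" "cube_m A \<noteq> 0" "stretch k l A = stretch k' l A"
  shows "k = k'"
  using assms by (cases A) auto

section \<open>Counting orbits\<close>

text \<open>One fixed primitive cube for given data. For nonzero \<mu> and \<nu>,
  \<open>prim_cube_unique\<close> shows that any other choice is a \<open>stretch k 1\<close> of
  it.\<close>

definition pick_cube :: "int \<Rightarrow> int \<times> int \<Rightarrow> int \<times> int \<Rightarrow> cube" where
  "pick_cube D = (\<lambda>(\<mu>, \<beta>) (\<nu>, \<gamma>). SOME A. prim_cube A \<and> cube_m A = \<mu> \<and> cube_n A = \<nu> \<and>
     cube_disc A = D \<and> cube_beta A = \<beta> \<and> cube_gamma A = \<gamma>)"

text \<open>A signed value \<mu> together with a root modulo \<open>4 * \<mu>\<close>. The window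
  has length \<open>2 * m\<close> because shears translate roots by multiples of
  \<open>2 * \<mu>\<close>.\<close>

definition root_pairs :: "int \<Rightarrow> nat \<Rightarrow> (int \<times> int) set" where
  "root_pairs D m = {(\<mu>, \<beta>). \<bar>\<mu>\<bar> = int m \<and> 0 \<le> \<beta> \<and> \<beta> < 2 * int m \<and> [\<beta>\<^sup>2 = D] (mod 4 * \<mu>)}"

lemma pick_cube:
  assumes "(\<mu>, \<beta>) \<in> root_pairs D m" "(\<nu>, \<gamma>) \<in> root_pairs D n"
  defines "A \<equiv> pick_cube D (\<mu>, \<beta>) (\<nu>, \<gamma>)"
  shows "prim_cube A" "cube_m A = \<mu>" "cube_n A = \<nu>" "cube_disc A = D"
    "cube_beta A = \<beta>" "cube_gamma A = \<gamma>" "\<mu> \<noteq> 0" "\<nu> \<noteq> 0"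
proof -
  show nz: "\<mu> \<noteq> 0" "\<nu> \<noteq> 0" using assms by (auto simp: root_pairs_def)
  have "[\<beta>\<^sup>2 = D] (mod 4 * \<mu>)" "[\<gamma>\<^sup>2 = D] (mod 4 * \<nu>)"
    using assms by (auto simp: root_pairs_def)
  from prim_cube_exists[OF nz this] have "\<exists>A. prim_cube A \<and> cube_m A = \<mu> \<and> cube_n A = \<nu> \<and>
     cube_disc A = D \<and> cube_beta A = \<beta> \<and> cube_gamma A = \<gamma>" by metis
  from someI_ex[OF this] show "prim_cube A" "cube_m A = \<mu>" "cube_n A = \<nu>" "cube_disc A = D"
    "cube_beta A = \<beta>" "cube_gamma A = \<gamma>"
    unfolding A_def pick_cube_def by simp_all
qed

lemma prim_cube_root_pairs:
  assumes "prim_cube A" "cube_disc A = D"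
    and "\<bar>cube_m A\<bar> = int m" "\<bar>cube_n A\<bar> = int n"
    and "0 \<le> cube_beta A" "cube_beta A < 2 * int m" "0 \<le> cube_gamma A" "cube_gamma A < 2 * int n"
  shows "(cube_m A, cube_beta A) \<in> root_pairs D m" "(cube_n A, cube_gamma A) \<in> root_pairs D n"
proof -
  obtain a b c d e f g h where A: "A = Cube a b c d e f g h" by (cases A)
  have "(cube_beta A)\<^sup>2 - D = 4 * cube_m A * (e * h - f * g)"
    unfolding assms(2)[symmetric] A cube_disc_eq_beta by (simp only: diff_diff_eq2 add_diff_cancel_left')
  moreover have "(cube_gamma A)\<^sup>2 - D = 4 * cube_n A * (b * h - d * f)"
    unfolding assms(2)[symmetric] A cube_disc_eq_gamma by (simp only: diff_diff_eq2 add_diff_cancel_left')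
  ultimately have "4 * cube_m A dvd (cube_beta A)\<^sup>2 - D" "4 * cube_n A dvd (cube_gamma A)\<^sup>2 - D"
    by simp_all
  with assms show "(cube_m A, cube_beta A) \<in> root_pairs D m" "(cube_n A, cube_gamma A) \<in> root_pairs D n"
    by (simp_all add: root_pairs_def cong_iff_dvd_diff)
qed

text \<open>The components are the content \<open>d\<close> of the second row, the multiple
  \<open>k\<close> of the primitive row modulo \<open>d\<close>, and the root data for the
  invariants divided by \<open>d\<close>.\<close>

definition orbit_index :: "int \<Rightarrow> nat \<Rightarrow> nat \<Rightarrow> (nat \<times> int \<times> (int \<times> int) \<times> (int \<times> int)) set" where
  "orbit_index D m n =
     (SIGMA d:{d. int d dvd square_part D \<and> d dvd m \<and> d dvd n}.
        {0..<int d} \<times> root_pairs (D div (int d)\<^sup>2) (m div d) \<times> root_pairs (D div (int d)\<^sup>2) (n div d))"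

definition orbit_rep :: "int \<Rightarrow> nat \<times> int \<times> (int \<times> int) \<times> (int \<times> int) \<Rightarrow> cube" where
  "orbit_rep D = (\<lambda>(d, k, x, y). stretch k (int d) (pick_cube (D div (int d)\<^sup>2) x y))"

text \<open>Absolute values collect the four sign choices of the two invariants, as the Dirichlet
  series does.\<close>

definition cubes_with :: "int \<Rightarrow> nat \<Rightarrow> nat \<Rightarrow> cube set" where
  "cubes_with D m n = {A. cube_disc A = D \<and> \<bar>cube_m A\<bar> = int m \<and> \<bar>cube_n A\<bar> = int n}"

lemma orbit_rep_in_cubes_with:
  assumes "i \<in> orbit_index D m n"
  shows "orbit_rep D i \<in> cubes_with D m n"
proof -
  obtain d k \<mu> \<beta> \<nu> \<gamma> where i: "i = (d, k, (\<mu>, \<beta>), (\<nu>, \<gamma>))" by (metis prod.exhaust)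
  have d: "int d dvd square_part D" "d dvd m" "d dvd n"
    and r: "(\<mu>, \<beta>) \<in> root_pairs (D div (int d)\<^sup>2) (m div d)"
      "(\<nu>, \<gamma>) \<in> root_pairs (D div (int d)\<^sup>2) (n div d)"
    using assms by (auto simp: i orbit_index_def)
  have "(int d)\<^sup>2 dvd D" using d by (simp add: dvd_square_part_iff)
  moreover have "\<bar>\<mu>\<bar> = int (m div d)" "\<bar>\<nu>\<bar> = int (n div d)" using r by (auto simp: root_pairs_def)
  ultimately show ?thesis
    using d(2,3) by (simp add: i orbit_rep_def cubes_with_def stretch_invariants pick_cube[OF r] abs_mult
        flip: of_nat_mult)
qed

lemma same_residue:
  fixes x y u \<mu> :: int
  assumes "y = x + 2 * u * \<mu>" "0 \<le> x" "x < 2 * \<bar>\<mu>\<bar>" "0 \<le> y" "y < 2 * \<bar>\<mu>\<bar>"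
  shows "u = 0"
proof (rule ccontr)
  assume "u \<noteq> 0"
  then have "1 * \<bar>\<mu>\<bar> \<le> \<bar>u\<bar> * \<bar>\<mu>\<bar>" by (intro mult_right_mono) auto
  moreover have "\<bar>u\<bar> * \<bar>\<mu>\<bar> = \<bar>u * \<mu>\<bar>" by (simp add: abs_mult)
  moreover have "2 * (u * \<mu>) = y - x" using assms(1) by simp
  ultimately show False using assms(2-) by linarith
qed

text \<open>The components are recovered in turn: \<open>d\<close> as content, \<mu> and \<nu> as
  invariants, \<beta> and \<gamma> as reduced roots, and finally \<open>k\<close> modulo
  \<open>d\<close>.\<close>

lemma orbit_rep_inj:
  assumes "i \<in> orbit_index D m n" "i' \<in> orbit_index D m n"
    and mn: "m > 0" "n > 0"
    and "cube_eqv (orbit_rep D i) (orbit_rep D i')"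
  shows "i = i'"
proof -
  obtain d k \<mu> \<beta> \<nu> \<gamma> where i: "i = (d, k, (\<mu>, \<beta>), (\<nu>, \<gamma>))" by (metis prod.exhaust)
  obtain d' k' \<mu>' \<beta>' \<nu>' \<gamma>' where i': "i' = (d', k', (\<mu>', \<beta>'), (\<nu>', \<gamma>'))" by (metis prod.exhaust)
  have d: "d > 0" "d' > 0" and k: "0 \<le> k" "k < int d" "0 \<le> k'" "k' < int d'"
    and r: "(\<mu>, \<beta>) \<in> root_pairs (D div (int d)\<^sup>2) (m div d)"
      "(\<nu>, \<gamma>) \<in> root_pairs (D div (int d)\<^sup>2) (n div d)"
    and r': "(\<mu>', \<beta>') \<in> root_pairs (D div (int d')\<^sup>2) (m div d')"
      "(\<nu>', \<gamma>') \<in> root_pairs (D div (int d')\<^sup>2) (n div d')"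
    using assms(1,2) mn by (auto simp: i i' orbit_index_def)
  define A where "A = pick_cube (D div (int d)\<^sup>2) (\<mu>, \<beta>) (\<nu>, \<gamma>)"
  define B where "B = pick_cube (D div (int d')\<^sup>2) (\<mu>', \<beta>') (\<nu>', \<gamma>')"
  note pA = pick_cube[OF r, folded A_def] and pB = pick_cube[OF r', folded B_def]
  obtain u t S where S: "det S = 1"
    and eq0: "cube_act (move u t S) (stretch k (int d) A) = stretch k' (int d') B"
    using assms(5) cube_group_eq_move unfolding cube_eqv_def i i' orbit_rep_def A_def B_def prod.case
    by metis
  let ?A = "cube_act (move u t (mat 1)) A"
  \<comment> \<open>Shears commute with \<open>stretch\<close>, so they are absorbed into
    \<open>?A\<close> and a pure row operation remains.\<close>
  have eq: "cube_act (move 0 0 S) (stretch k (int d) ?A) = stretch k' (int d') B"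
    using eq0 by (subst (asm) cube_act_move) (simp only: cube_act_shear_stretch)
  obtain q where dd: "int d' = int d" and st: "stretch k' (int d) B = stretch (k + q * int d) (int d) ?A"
    using d stretch_prim_rows[OF prim_cube_shear[OF pA(1)] pB(1) _ _ S eq] by auto
  have mA: "cube_m ?A = cube_m A" "cube_n ?A = cube_n A"
    using cube_act_invariants move_in_cube_group[of "mat 1"] by simp_all
  have dd': "d' = d" using dd by simp
  have \<mu>: "\<mu>' = \<mu>" using arg_cong[OF st, of cube_m] d pA pB mA by (simp add: stretch_invariants)
  have \<nu>: "\<nu>' = \<nu>" using arg_cong[OF st, of cube_n] d pA pB mA by (simp add: stretch_invariants)
  have \<beta>: "\<beta>' = \<beta> - 2 * u * \<mu>"
    using arg_cong[OF st, of cube_beta] d pA pB by (simp add: stretch_invariants cube_beta_shear)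
  have \<gamma>: "\<gamma>' = \<gamma> + 2 * t * \<nu>"
    using arg_cong[OF st, of cube_gamma] d pA pB by (simp add: stretch_invariants cube_gamma_shear)
  \<comment> \<open>Both roots lie in one window of length \<open>2 * \<bar>\<mu>\<bar>\<close>, so
    the shear between them is trivial; the same holds for \<gamma>.\<close>
  have "- u = 0" by (rule same_residue[of \<beta>' \<beta> _ \<mu>]) (use \<beta> r r' \<mu> in \<open>auto simp: root_pairs_def\<close>)
  moreover have "t = 0" by (rule same_residue[of \<gamma>' \<gamma> _ \<nu>]) (use \<gamma> r r' \<nu> in \<open>auto simp: root_pairs_def\<close>)
  ultimately have ut: "u = 0" "t = 0" by simp_all
  then have bg: "\<beta>' = \<beta>" "\<gamma>' = \<gamma>" using \<beta> \<gamma> by simp_all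
  then have "B = A" unfolding A_def B_def by (simp add: \<mu> \<nu> dd')
  then have "k' = k + q * int d"
    using st stretch_inject[OF pA(1), of k' "int d" "k + q * int d"] pA
    by (simp add: ut cube_act_shear_0)
  then have "k' mod int d = k mod int d" by simp
  then have "k' = k" using k by (simp add: dd')
  then show ?thesis using i i' dd' \<mu> \<nu> bg by simp
qed

text \<open>Normalise the first column, split off the content \<open>l\<close>, shear both roots
  into their windows, compare with the picked cube, and reduce the remaining multiple modulo
  \<open>l\<close>.\<close>

lemma orbit_rep_surj:
  assumes "A \<in> cubes_with D m n" "m > 0" "n > 0"
  obtains i where "i \<in> orbit_index D m n" "cube_eqv A (orbit_rep D i)"
proof -
  have A: "cube_disc A = D" "\<bar>cube_m A\<bar> = int m" "\<bar>cube_n A\<bar> = int n" "cube_m A \<noteq> 0" "cube_n A \<noteq> 0"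
    using assms by (auto simp: cubes_with_def)
  obtain a b d e f g h where "a > 0" and A1: "cube_eqv A (Cube a b 0 d e f g h)"
    using cube_eqv_first_column A by metis
  moreover have "cube_m (Cube a b 0 d e f g h) \<noteq> 0" using cube_eqv_invariants[OF A1] A by simp
  ultimately obtain P where P: "prim_cube P" and l: "gcd d (gcd g h) > 0"
    and "Cube a b 0 d e f g h = stretch 0 (gcd d (gcd g h)) P"
    using stretch_prim_cube by metis
  then obtain l where l: "l > 0" and AP: "cube_eqv A (stretch 0 (int l) P)"
    using A1 zero_less_imp_eq_int by metis
  define \<mu> \<nu> where "\<mu> = cube_m P" and "\<nu> = cube_n P"
  have inv: "int l * \<mu> = cube_m A" "int l * \<nu> = cube_n A" "(int l)\<^sup>2 * cube_disc P = D"
    using cube_eqv_invariants[OF AP] A(1) by (simp_all add: stretch_invariants \<mu>_def \<nu>_def)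
  then have nz: "\<mu> \<noteq> 0" "\<nu> \<noteq> 0" using A by auto
  have m: "m = l * nat \<bar>\<mu>\<bar>" and n: "n = l * nat \<bar>\<nu>\<bar>"
    using A(2,3) unfolding inv(1,2)[symmetric]
    by (metis abs_mult abs_of_nat nat_int nat_mult_distrib of_nat_0_le_iff)+
  have D: "cube_disc P = D div (int l)\<^sup>2" using inv(3) l by (simp flip: inv(3))
  \<comment> \<open>The sign factors turn the signed steps \<open>2 * \<mu>\<close> and
    \<open>2 * \<nu>\<close> into steps by absolute values; \<open>t\<close> carries a minus because
    \<gamma> increases with \<open>t\<close>.\<close>
  define u where "u = sgn \<mu> * (cube_beta P div (2 * \<bar>\<mu>\<bar>))"
  define t where "t = - sgn \<nu> * (cube_gamma P div (2 * \<bar>\<nu>\<bar>))"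
  define Q where "Q = cube_act (move u t (mat 1)) P"
  have "cube_beta Q = cube_beta P - 2 * \<bar>\<mu>\<bar> * (cube_beta P div (2 * \<bar>\<mu>\<bar>))"
    unfolding Q_def cube_beta_shear u_def \<mu>_def[symmetric] by (simp add: abs_sgn algebra_simps)
  then have bQ: "cube_beta Q = cube_beta P mod (2 * \<bar>\<mu>\<bar>)" by (simp add: minus_mult_div_eq_mod)
  have "cube_gamma Q = cube_gamma P - 2 * \<bar>\<nu>\<bar> * (cube_gamma P div (2 * \<bar>\<nu>\<bar>))"
    unfolding Q_def cube_gamma_shear t_def \<nu>_def[symmetric] by (simp add: abs_sgn algebra_simps)
  then have gQ: "cube_gamma Q = cube_gamma P mod (2 * \<bar>\<nu>\<bar>)" by (simp add: minus_mult_div_eq_mod)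
  have Q: "prim_cube Q" "cube_disc Q = D div (int l)\<^sup>2" "cube_m Q = \<mu>" "cube_n Q = \<nu>"
    unfolding Q_def using prim_cube_shear[OF P] cube_act_invariants move_in_cube_group[of "mat 1"]
    by (simp_all add: D \<mu>_def \<nu>_def)
  have root: "(\<mu>, cube_beta Q) \<in> root_pairs (D div (int l)\<^sup>2) (m div l)"
     "(\<nu>, cube_gamma Q) \<in> root_pairs (D div (int l)\<^sup>2) (n div l)"
    using prim_cube_root_pairs[OF Q(1,2), of "m div l" "n div l"] nz l
    by (simp_all add: Q m n bQ gQ)
  define R where "R = pick_cube (D div (int l)\<^sup>2) (\<mu>, cube_beta Q) (\<nu>, cube_gamma Q)"
  note R = pick_cube[OF root, folded R_def]
  obtain j where j: "Q = stretch j 1 R"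
    using prim_cube_unique[OF R(1) Q(1)] R Q by metis
  have "cube_eqv A (stretch 0 (int l) Q)"
    using cube_eqv_trans[OF AP cube_eqv_shear[of _ u t]] by (simp add: cube_act_shear_stretch Q_def)
  then have "cube_eqv A (stretch j (int l) R)" by (simp add: j stretch_stretch)
  then have "cube_eqv A (stretch (j + - (j div int l) * int l) (int l) R)"
    using cube_eqv_trans stretch_eqv by blast
  then have "cube_eqv A (stretch (j mod int l) (int l) R)"
    by (simp add: minus_div_mult_eq_mod)
  then have "cube_eqv A (orbit_rep D (l, j mod int l, (\<mu>, cube_beta Q), (\<nu>, cube_gamma Q)))"
    by (simp add: orbit_rep_def R_def)
  moreover have "int l dvd square_part D"
    unfolding dvd_square_part_iff inv(3)[symmetric] by simp
  then have "(l, j mod int l, (\<mu>, cube_beta Q), (\<nu>, cube_gamma Q)) \<in> orbit_index D m n"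
    using root l m n by (simp add: orbit_index_def)
  ultimately show thesis using that by blast
qed

lemma bij_betw_orbit_rep:
  assumes "m > 0" "n > 0"
  shows "bij_betw (cube_orbit \<circ> orbit_rep D) (orbit_index D m n) (cube_orbit ` cubes_with D m n)"
proof (rule bij_betw_imageI)
  show "inj_on (cube_orbit \<circ> orbit_rep D) (orbit_index D m n)"
    using orbit_rep_inj assms by (auto simp: inj_on_def cube_orbit_eq_iff)
  have "\<exists>i\<in>orbit_index D m n. cube_orbit A = cube_orbit (orbit_rep D i)"
    if "A \<in> cubes_with D m n" for A
    using orbit_rep_surj[OF that assms] by (metis cube_orbit_eq_iff)
  then show "(cube_orbit \<circ> orbit_rep D) ` orbit_index D m n = cube_orbit ` cubes_with D m n"
    using orbit_rep_in_cubes_with by fastforce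
qed

text \<open>Shifting \<open>x\<close> by \<open>2m\<close> does not change \<open>x\<^sup>2\<close> modulo \<open>4m\<close>, so the two signs of \<open>\<mu>\<close> account
  for the two halves of \<open>{0..<4m}\<close>.\<close>

lemma card_root_pairs:
  assumes "m > 0"
  shows "finite (root_pairs D m)" "card (root_pairs D m) = sqrt_count D (4 * m)"
proof -
  define f :: "int \<Rightarrow> int \<times> int" where
    "f = (\<lambda>x. if x < 2 * int m then (int m, x) else (- int m, x - 2 * int m))"
  define X where "X = {x \<in> {0..<4 * int m}. [x\<^sup>2 = D] (mod 4 * int m)}"
  have sq: "[(x + 2 * int m)\<^sup>2 = D] (mod 4 * int m) \<longleftrightarrow> [x\<^sup>2 = D] (mod 4 * int m)" for x
  proof -
    have "(x + 2 * int m)\<^sup>2 - D = (x\<^sup>2 - D) + 4 * int m * (x + int m)"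
      by (simp add: power2_eq_square algebra_simps)
    then show ?thesis unfolding cong_iff_dvd_diff by (metis dvd_add_times_triv_right_iff mult.commute)
  qed
  have sgn: "[a = D] (mod - (4 * int m)) \<longleftrightarrow> [a = D] (mod 4 * int m)" for a
    unfolding cong_iff_dvd_diff by (rule minus_dvd_iff)
  have sgn': "[a = D] (mod 4 * int m)" if "[a = D] (mod 4 * \<mu>)" "- \<mu> = int m" for a \<mu>
    using that sgn by (simp flip: that(2))
  have "bij_betw f X (root_pairs D m)"
  proof (rule bij_betw_byWitness[where f' = "\<lambda>(\<mu>, x). if \<mu> > 0 then x else x + 2 * int m"])
    show "f ` X \<subseteq> root_pairs D m"
      using sq[of "x - 2 * int m" for x] by (auto simp: f_def X_def root_pairs_def sgn)
    show "(\<lambda>(\<mu>, x). if \<mu> > 0 then x else x + 2 * int m) ` root_pairs D m \<subseteq> X"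
      using assms by (auto simp: X_def root_pairs_def sq abs_if intro: sgn' split: if_splits)
  qed (use assms in \<open>auto simp: f_def X_def root_pairs_def\<close>)
  moreover have "finite X" unfolding X_def by (rule finite_subset[of _ "{0..<4 * int m}"]) auto
  ultimately show "finite (root_pairs D m)" "card (root_pairs D m) = sqrt_count D (4 * m)"
    using bij_betw_finite bij_betw_same_card by (force simp: sqrt_count_def X_def)+
qed

lemma card_orbits_with:
  assumes "m > 0" "n > 0"
  shows "finite (cube_orbit ` cubes_with D m n)"
    and "card (cube_orbit ` cubes_with D m n) = B_coeff D m n"
proof -
  let ?I = "{d. int d dvd square_part D \<and> d dvd m \<and> d dvd n}"
  have I: "finite ?I" using assms by (auto intro: finite_subset[of _ "{d. d dvd m}"])
  have pos: "m div d > 0" "n div d > 0" if "d \<in> ?I" for d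
    using that assms by (auto elim!: dvdE)
  have "finite (orbit_index D m n)"
    unfolding orbit_index_def using I pos card_root_pairs by (intro finite_SigmaI finite_cartesian_product) auto
  then show "finite (cube_orbit ` cubes_with D m n)"
    using bij_betw_orbit_rep[OF assms] bij_betw_finite by blast
  \<comment> \<open>The weight \<open>d\<close> in \<open>B_coeff\<close> counts the residues
    \<open>k\<close>, and \<open>4 * m div d = 4 * (m div d)\<close> matches the root
    counts.\<close>
  have "card (orbit_index D m n) = B_coeff D m n"
    unfolding orbit_index_def B_coeff_def using I pos
    by (subst card_SigmaI) (auto simp: card_root_pairs card_cartesian_product div_mult_swap mult.assoc intro!: sum.cong)
  then show "card (cube_orbit ` cubes_with D m n) = B_coeff D m n"
    using bij_betw_orbit_rep[OF assms] bij_betw_same_card by metis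
qed

section \<open>Convergence\<close>

text \<open>Fix one root \<open>x0\<close>. For every root \<open>x\<close> some factorisation \<open>a = r t\<close> has \<open>r dvd x - x0\<close> and
  \<open>t dvd x + x0\<close>, so \<open>x\<close> is determined modulo \<open>lcm r t = a / gcd r t\<close>.\<close>

lemma sqrt_count_le:
  assumes "a > 0"
  shows "sqrt_count D a \<le> (\<Sum>r | r dvd a. gcd r (a div r))"
proof -
  define X where "X = {x \<in> {0..<int a}. [x\<^sup>2 = D] (mod int a)}"
  define Y where "Y = (\<lambda>x0 r. {x \<in> {0..<int a}. int r dvd x - x0 \<and> int (a div r) dvd x + x0})"
  have card_Y: "card (Y x0 r) \<le> gcd r (a div r)" if "r dvd a" for x0 r
  proof -
    define L where "L = lcm r (a div r)"
    have r: "r > 0" "a div r > 0" using that assms by (auto elim!: dvdE)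
    have aL: "a = gcd r (a div r) * L"
      using prod_gcd_lcm_nat[of r "a div r"] that by (simp add: L_def)
    have L: "L > 0" unfolding L_def using r lcm_pos_nat by blast
    \<comment> \<open>\<open>Y x0 r\<close> lies in one residue class modulo \<open>L\<close>, so
      quotients by \<open>L\<close> separate its points; these quotients are below
      \<open>a / L\<close>, which is the gcd.\<close>
    have "inj_on (\<lambda>x. x div int L) (Y x0 r)"
    proof (rule inj_onI)
      fix x y assume xy: "x \<in> Y x0 r" "y \<in> Y x0 r" "x div int L = y div int L"
      have "int r dvd (x - x0) - (y - x0)" "int (a div r) dvd (x + x0) - (y + x0)"
        using xy unfolding Y_def by (blast intro: dvd_diff)+
      then have "int L dvd x - y" unfolding L_def by (simp add: lcm_least flip: lcm_int_int_eq)
      then have "x mod int L = y mod int L" by (simp add: mod_eq_dvd_iff)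
      then show "x = y" using xy(3) by (metis div_mult_mod_eq)
    qed
    moreover have "(\<lambda>x. x div int L) ` Y x0 r \<subseteq> {0..<int (gcd r (a div r))}"
    proof
      fix z assume "z \<in> (\<lambda>x. x div int L) ` Y x0 r"
      then obtain x where z: "z = x div int L" and "0 \<le> x" "x < int a" by (auto simp: Y_def)
      then have "x < int (gcd r (a div r)) * int L" using aL by (metis of_nat_mult)
      moreover have "x div int L * int L \<le> x"
        using L by (simp flip: minus_mod_eq_div_mult)
      ultimately have "z * int L < int (gcd r (a div r)) * int L" unfolding z by linarith
      then show "z \<in> {0..<int (gcd r (a div r))}"
        using \<open>0 \<le> x\<close> L by (simp add: z pos_imp_zdiv_nonneg_iff)
    qed
    ultimately have "card (Y x0 r) \<le> card {0..<int (gcd r (a div r))}"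
      by (rule card_inj_on_le) simp
    then show ?thesis by simp
  qed
  have count: "sqrt_count D a = card X" unfolding sqrt_count_def X_def ..
  have fin: "finite {r. r dvd a}" using assms by simp
  show ?thesis
  proof (cases "X = {}")
    case True
    then show ?thesis unfolding count by simp
  next
    case False
    then obtain x0 where x0: "x0 \<in> X" by blast
    have "X \<subseteq> (\<Union>r\<in>{r. r dvd a}. Y x0 r)"
    proof
      fix x assume x: "x \<in> X"
      have "[x\<^sup>2 = x0\<^sup>2] (mod int a)"
        using x x0 by (auto simp: X_def intro: cong_trans cong_sym)
      then have "int a dvd (x - x0) * (x + x0)"
        by (simp add: cong_iff_dvd_diff power2_eq_square algebra_simps)
      \<comment> \<open>The two factors may be negative, hence the absolute values below.\<close>
      then obtain b c where bc: "int a = b * c" "b dvd x - x0" "c dvd x + x0"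
        using division_decomp by blast
      have "a = nat \<bar>b\<bar> * nat \<bar>c\<bar>"
        using bc(1) by (metis abs_mult abs_of_nat nat_int nat_mult_distrib abs_ge_zero)
      moreover from this have "a div nat \<bar>b\<bar> = nat \<bar>c\<bar>" using assms by auto
      ultimately have "nat \<bar>b\<bar> dvd a" "x \<in> Y x0 (nat \<bar>b\<bar>)"
        using bc x by (simp_all add: Y_def X_def)
      then show "x \<in> (\<Union>r\<in>{r. r dvd a}. Y x0 r)" by blast
    qed
    then have "card X \<le> card (\<Union>r\<in>{r. r dvd a}. Y x0 r)"
      by (rule card_mono[rotated]) (use fin in \<open>auto simp: Y_def intro: finite_subset[of _ "{0..<int a}"]\<close>)
    also have "\<dots> \<le> (\<Sum>r | r dvd a. card (Y x0 r))" by (rule card_UN_le[OF fin])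
    also have "\<dots> \<le> (\<Sum>r | r dvd a. gcd r (a div r))" using card_Y by (intro sum_mono) simp
    finally show ?thesis unfolding count .
  qed
qed

section \<open>Summable majorants\<close>

lemma summable_on_times:
  fixes f :: "'a \<Rightarrow> real" and g :: "'b \<Rightarrow> real"
  assumes "f summable_on A" "g summable_on B"
  shows "(\<lambda>(x, y). f x * g y) summable_on A \<times> B"
proof -
  have "(\<lambda>x. norm (f x)) summable_on A" "(\<lambda>y. norm (g y)) summable_on B"
    using assms summable_on_iff_abs_summable_on_real by blast+
  then have "(\<lambda>p. norm (case p of (x, y) \<Rightarrow> f x * g y)) summable_on A \<times> B"
    by (subst Infinite_Sum.abs_summable_on_Sigma_iff)
       (auto simp: abs_mult infsum_cmult_right intro!: summable_on_cmult_right summable_on_cmult_left)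
  then show ?thesis by (rule abs_summable_summable)
qed

lemma summable_on_powr_nat:
  fixes s :: real
  assumes "s > 1"
  shows "(\<lambda>n. real n powr - s) summable_on {0<..}"
proof -
  have "summable (\<lambda>n. real n powr - s)" using assms by (simp add: summable_real_powr_iff)
  then have "(\<lambda>n. real n powr - s) summable_on UNIV"
    by (subst summable_on_UNIV_nonneg_real_iff) auto
  then show ?thesis by (rule summable_on_subset_banach) simp
qed

lemma summable_on_powr_int:
  fixes s :: real
  assumes "s > 1"
  shows "(\<lambda>D. real_of_int \<bar>D\<bar> powr - s) summable_on {D. D \<noteq> 0}"
proof -
  have "(\<lambda>D. real_of_int \<bar>D\<bar> powr - s) summable_on int ` {0<..}"
    "(\<lambda>D. real_of_int \<bar>D\<bar> powr - s) summable_on (\<lambda>n. - int n) ` {0<..}"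
    using summable_on_powr_nat[OF assms]
    by (subst summable_on_reindex; force simp: inj_on_def o_def)+
  then have "(\<lambda>D. real_of_int \<bar>D\<bar> powr - s) summable_on int ` {0<..} \<union> (\<lambda>n. - int n) ` {0<..}"
    by (rule summable_on_union)
  moreover have "D \<in> int ` {0<..} \<union> (\<lambda>n. - int n) ` {0<..}" if "D \<noteq> 0" for D
  proof (cases "D > 0")
    case True
    then show ?thesis by (intro UnI1 image_eqI[of _ _ "nat D"]) auto
  next
    case False
    then show ?thesis using that by (intro UnI2 image_eqI[of _ _ "nat (- D)"]) auto
  qed
  ultimately show ?thesis
    by (auto elim!: summable_on_subset_banach)
qed

text \<open>Writing \<open>r = g*x\<close>, \<open>t = g*y\<close> with \<open>g\<close> the gcd
  turns the term into \<open>g powr - (2*s - 1)\<close> times \<open>x powr - s\<close> times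
  \<open>y powr - s\<close>. Dropping the coprimality of \<open>x\<close> and \<open>y\<close>
  bounds the sum by a product of three convergent series.\<close>

lemma summable_on_gcd_powr:
  fixes s :: real
  assumes "s > 1"
  shows "(\<lambda>(r, t). real (gcd r t) * real (r * t) powr - s) summable_on {0<..} \<times> {0<..}"
proof -
  let ?F = "\<lambda>(g, x, y). real g powr - (2 * s - 1) * (real x powr - s * real y powr - s)"
  let ?h = "\<lambda>(r :: nat, t :: nat). (gcd r t, r div gcd r t, t div gcd r t)"
  have "(\<lambda>(g, xy). real g powr - (2 * s - 1) * (case xy of (x, y) \<Rightarrow> real x powr - s * real y powr - s))
      summable_on {0<..} \<times> ({0<..} \<times> {0<..})"
    using assms by (intro summable_on_times summable_on_powr_nat) auto
  then have "?F summable_on {0<..} \<times> ({0<..} \<times> {0<..})"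
    by (rule summable_on_cong[THEN iffD1, rotated]) auto
  then have "?F summable_on ?h ` ({0<..} \<times> {0<..})"
    by (rule summable_on_subset_banach) (auto simp: div_greater_zero_iff dvd_imp_le)
  moreover have "inj_on ?h ({0<..} \<times> {0<..})"
    by (rule inj_on_inverseI[where g = "\<lambda>(g, x, y). (g * x, g * y)"])
       (auto simp: dvd_mult_div_cancel)
  ultimately have "(?F \<circ> ?h) summable_on {0<..} \<times> {0<..}"
    by (simp only: summable_on_reindex)
  moreover have "(?F \<circ> ?h) (r, t) = real (gcd r t) * real (r * t) powr - s"
    if "r > 0" "t > 0" for r t :: nat
  proof -
    define g where "g = gcd r t"
    obtain x y where xy: "r = g * x" "t = g * y" unfolding g_def by (metis dvdE gcd_dvd1 gcd_dvd2)
    have g: "g > 0" using that by (simp add: g_def)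
    have pos: "x > 0" "y > 0" using xy that by auto
    have "real g powr - (2 * s - 1) = real g powr (1 + (- s + - s))" by (simp add: algebra_simps)
    also have "\<dots> = real g * (real g powr - s * real g powr - s)"
      using g by (simp only: powr_add powr_one)
    finally show ?thesis
      using g pos by (simp add: powr_mult mult_ac flip: g_def) (simp add: xy powr_mult mult_ac)
  qed
  ultimately show ?thesis
    by (elim summable_on_cong[THEN iffD1, rotated]) auto
qed

text \<open>Grouping the pairs \<open>(r, t)\<close> by their product \<open>a = r * t\<close>
  reduces this to \<open>summable_on_gcd_powr\<close>.\<close>

lemma summable_on_divisor_gcd:
  fixes s :: real
  assumes "s > 1"
  shows "(\<lambda>a. (\<Sum>r | r dvd a. real (gcd r (a div r))) * real a powr - s) summable_on {0<..}"
proof -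
  let ?h = "\<lambda>(a, r). (r, a div r)"
  let ?S = "SIGMA a:{0<..}. {r. r dvd a}"
  have "bij_betw ?h ?S ({0<..} \<times> {0<..} :: (nat \<times> nat) set)"
    by (rule bij_betw_byWitness[where f' = "\<lambda>(r, t). (r * t, r)"]) (auto elim!: dvdE)
  then have "(\<lambda>p. (\<lambda>(r, t). real (gcd r t) * real (r * t) powr - s) (?h p)) summable_on ?S"
    using summable_on_gcd_powr[OF assms] by (subst summable_on_reindex_bij_betw)
  then have "(\<lambda>(a, r). real (gcd r (a div r)) * real a powr - s) summable_on ?S"
    by (rule summable_on_cong[THEN iffD1, rotated]) auto
  then have "(\<lambda>a. \<Sum>\<^sub>\<infinity>r\<in>{r. r dvd a}. real (gcd r (a div r)) * real a powr - s) summable_on {0<..}"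
    by (rule summable_on_Sigma_banach)
  then show ?thesis
    by (rule summable_on_cong[THEN iffD1, rotated]) (simp add: sum_distrib_right)
qed

text \<open>The majorant is independent of \<open>D\<close>, which decouples the summations over
  \<open>D\<close>, \<open>m\<close> and \<open>n\<close>.\<close>

lemma sqrt_count_majorant:
  fixes s :: real
  assumes "s > 1"
  obtains g :: "nat \<Rightarrow> real" where "g summable_on {0<..}"
    "\<And>D m. m > 0 \<Longrightarrow> real (sqrt_count D (4 * m)) * real m powr - s \<le> g m"
proof -
  define H where "H = (\<lambda>a. (\<Sum>r | r dvd a. real (gcd r (a div r))) * real a powr - s)"
  have "H summable_on (\<lambda>m. 4 * m) ` {0<..}"
    by (rule summable_on_subset_banach[OF summable_on_divisor_gcd[OF assms, folded H_def]]) auto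
  then have "(\<lambda>m. H (4 * m)) summable_on {0<..}"
    by (subst (asm) summable_on_reindex) (auto simp: inj_on_def o_def)
  then have "(\<lambda>m. 4 powr s * H (4 * m)) summable_on {0<..}" by (rule summable_on_cmult_right)
  moreover have "real (sqrt_count D (4 * m)) * real m powr - s \<le> 4 powr s * H (4 * m)" if "m > 0" for D m
  proof -
    have "real (sqrt_count D (4 * m)) \<le> (\<Sum>r | r dvd 4 * m. real (gcd r (4 * m div r)))"
      using sqrt_count_le[of "4 * m" D] that by (simp flip: of_nat_sum)
    moreover have "real m powr - s = 4 powr s * real (4 * m) powr - s"
      by (simp add: powr_mult powr_minus field_simps)
    ultimately show ?thesis unfolding H_def by (simp add: mult_right_mono mult.left_commute)
  qed
  ultimately show thesis by (rule that)
qed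

abbreviation triples :: "(int \<times> nat \<times> nat) set" where
  "triples \<equiv> {D. D \<noteq> 0} \<times> ({0<..} \<times> {0<..})"

text \<open>Expand \<open>B_coeff\<close> into its divisor sum and substitute
  \<open>D = d\<^sup>2 * D'\<close>, \<open>m = d * m'\<close>, \<open>n = d * n'\<close>. The terms
  are then dominated by a product of four independent convergent series.\<close>

lemma summable_on_B_coeff:
  fixes s1 s2 w :: real
  assumes "s1 > 1" "s2 > 1" "w > 1"
  shows "(\<lambda>(D, m, n). real (B_coeff D m n) * (real_of_int \<bar>D\<bar> powr - w * (real m powr - s1 * real n powr - s2)))
           summable_on triples"
proof -
  obtain g1 where g1: "g1 summable_on {0<..}"
    and le1: "\<And>D m. m > 0 \<Longrightarrow> real (sqrt_count D (4 * m)) * real m powr - s1 \<le> g1 m"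
    using sqrt_count_majorant[OF assms(1)] by metis
  obtain g2 where g2: "g2 summable_on {0<..}"
    and le2: "\<And>D m. m > 0 \<Longrightarrow> real (sqrt_count D (4 * m)) * real m powr - s2 \<le> g2 m"
    using sqrt_count_majorant[OF assms(2)] by metis
  \<comment> \<open>After the substitution \<open>d\<close> has exponent
    \<open>1 - 2*w - s1 - s2\<close>; the 1 comes from the weight \<open>d\<close>.\<close>
  define \<sigma> where "\<sigma> = 2 * w + s1 + s2 - 1"
  define M where "M = (\<lambda>(d, D, m, n). real d powr - \<sigma> * (real_of_int \<bar>D\<bar> powr - w * (g1 m * g2 n)))"
  define divs where "divs = (\<lambda>(D, m, n). {d. int d dvd square_part D \<and> d dvd m \<and> d dvd n})"
  define h where "h = (\<lambda>((D :: int, m :: nat, n :: nat), d :: nat). (d, D div (int d)\<^sup>2, m div d, n div d))"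
  define term' where "term' = (\<lambda>((D, m, n), d). real (d * sqrt_count (D div (int d)\<^sup>2) (4 * m div d) *
    sqrt_count (D div (int d)\<^sup>2) (4 * n div d)) * (real_of_int \<bar>D\<bar> powr - w * (real m powr - s1 * real n powr - s2)))"
  have decomp: "\<exists>D' m' n'. D = (int d)\<^sup>2 * D' \<and> m = d * m' \<and> n = d * n' \<and>
      d > 0 \<and> D' \<noteq> 0 \<and> m' > 0 \<and> n' > 0 \<and> h ((D, m, n), d) = (d, D', m', n')"
    if "((D, m, n), d) \<in> Sigma triples divs" for D m n d
  proof -
    have "(int d)\<^sup>2 dvd D" "d dvd m" "d dvd n" and nz: "D \<noteq> 0" "m > 0" "n > 0"
      using that by (auto simp: divs_def dvd_square_part_iff)
    then obtain D' m' n' where *: "D = (int d)\<^sup>2 * D'" "m = d * m'" "n = d * n'"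
      by (elim dvdE)
    then show ?thesis using nz unfolding h_def by (intro exI[of _ D'] exI[of _ m'] exI[of _ n']) simp
  qed
  have "(\<lambda>(D, y). real_of_int \<bar>D\<bar> powr - w * (case y of (m, n) \<Rightarrow> g1 m * g2 n)) summable_on triples"
    by (rule summable_on_times[OF summable_on_powr_int[OF assms(3)] summable_on_times[OF g1 g2]])
  moreover have "\<sigma> > 1" using assms by (simp add: \<sigma>_def)
  ultimately have "(\<lambda>(d, x). real d powr - \<sigma> * (case x of (D, y) \<Rightarrow> real_of_int \<bar>D\<bar> powr - w *
      (case y of (m, n) \<Rightarrow> g1 m * g2 n))) summable_on {0<..} \<times> triples"
    by (rule summable_on_times[OF summable_on_powr_nat, rotated])
  then have "M summable_on {0<..} \<times> triples"
    by (rule summable_on_cong[THEN iffD1, rotated]) (clarsimp simp: M_def)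
  moreover have "h ` Sigma triples divs \<subseteq> {0<..} \<times> triples"
  proof
    fix x assume "x \<in> h ` Sigma triples divs"
    then obtain D m n d where "x = h ((D, m, n), d)" "((D, m, n), d) \<in> Sigma triples divs"
      by (elim imageE) (metis prod.exhaust)
    with decomp[of D m n d] show "x \<in> {0<..} \<times> triples" by clarsimp
  qed
  ultimately have "M summable_on h ` Sigma triples divs"
    by (rule summable_on_subset_banach)
  moreover have "inj_on h (Sigma triples divs)"
  proof (rule inj_onI)
    fix x y assume xy: "x \<in> Sigma triples divs" "y \<in> Sigma triples divs" "h x = h y"
    obtain D m n d where x: "x = ((D, m, n), d)" by (metis prod.exhaust)
    obtain E k l e where y: "y = ((E, k, l), e)" by (metis prod.exhaust)
    show "x = y" using decomp[OF xy(1)[unfolded x]] decomp[OF xy(2)[unfolded y]] xy(3) unfolding x y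
      by (elim exE conjE) simp
  qed
  ultimately have "(M \<circ> h) summable_on Sigma triples divs"
    by (simp only: summable_on_reindex)
  then have "(\<lambda>x. norm (M (h x))) summable_on Sigma triples divs"
    unfolding o_def by (rule summable_on_iff_abs_summable_on_real[THEN iffD1])
  then have "(\<lambda>x. norm (term' x)) summable_on Sigma triples divs"
  proof (rule Infinite_Sum.abs_summable_on_comparison_test)
    fix x assume x: "x \<in> Sigma triples divs"
    obtain D m n d where xe: "x = ((D, m, n), d)" by (metis prod.exhaust)
    obtain D' m' n' where *: "D = (int d)\<^sup>2 * D'" "m = d * m'" "n = d * n'"
      and pos: "d > 0" "D' \<noteq> 0" "m' > 0" "n' > 0" and hx: "h x = (d, D', m', n')"
      using decomp[OF x[unfolded xe]] unfolding xe by (elim exE conjE)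
    let ?a = "real (sqrt_count D' (4 * m'))" and ?b = "real (sqrt_count D' (4 * n'))"
    have quot: "D div (int d)\<^sup>2 = D'" "4 * m div d = 4 * m'" "4 * n div d = 4 * n'"
      using pos by (simp_all add: * mult.left_commute[of 4])
    have "real d powr - \<sigma> = real d powr (1 + (- w + (- w + (- s1 + - s2))))"
      unfolding \<sigma>_def by (rule arg_cong[where f = "\<lambda>t. real d powr t"]) simp
    also have "\<dots> = real d * (real d powr - w * (real d powr - w * (real d powr - s1 * real d powr - s2)))"
      using pos by (simp only: powr_add powr_one)
    finally have pw: "real d powr - \<sigma> =
      real d * (real d powr - w * (real d powr - w * (real d powr - s1 * real d powr - s2)))" .
    have "\<bar>real_of_int D\<bar> powr - w = \<bar>real_of_int D'\<bar> powr - w * (real d powr - w * real d powr - w)"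
      using pos by (simp add: * abs_mult powr_mult power2_eq_square)
    then have "term' x = real d powr - \<sigma> * (real_of_int \<bar>D'\<bar> powr - w *
        ((?a * real m' powr - s1) * (?b * real n' powr - s2)))"
      unfolding term'_def xe prod.case quot pw by (simp add: *(2,3) powr_mult mult_ac)
    \<comment> \<open>The majorants are nonnegative at these arguments because they dominate
      nonnegative terms.\<close>
    also have "\<dots> \<le> M (h x)"
      unfolding hx M_def prod.case using le1 le2 pos
      by (intro mult_left_mono mult_mono) (simp_all add: order_trans[OF _ le1])
    moreover have "term' x \<ge> 0" unfolding term'_def xe by simp
    ultimately show "norm (term' x) \<le> norm (M (h x))" by simp
  qed
  then have "term' summable_on Sigma triples divs" by (rule abs_summable_summable)
  then have "(\<lambda>(x, d). term' (x, d)) summable_on Sigma triples divs" by simp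
  then have "(\<lambda>x. \<Sum>\<^sub>\<infinity>d\<in>divs x. term' (x, d)) summable_on triples"
    by (rule summable_on_Sigma_banach)
  moreover have "(\<Sum>\<^sub>\<infinity>d\<in>divs (D, m, n). term' ((D, m, n), d)) =
      real (B_coeff D m n) * (real_of_int \<bar>D\<bar> powr - w * (real m powr - s1 * real n powr - s2))"
    if "m > 0" for D m n
  proof -
    have "finite (divs (D, m, n))"
      unfolding divs_def prod.case by (rule finite_subset[of _ "{d. d dvd m}"]) (use that in auto)
    then show ?thesis
      unfolding term'_def B_coeff_def prod.case
      by (simp add: divs_def flip: sum_distrib_right)
  qed
  ultimately show ?thesis
    by (elim summable_on_cong[THEN iffD1, rotated]) auto
qed

section \<open>Summation over the orbits\<close>

definition orbit_fibre :: "int \<times> nat \<times> nat \<Rightarrow> cube set set" where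
  "orbit_fibre = (\<lambda>(D, m, n). cube_orbit ` cubes_with D m n)"

lemma orbit_term_fibre:
  assumes "X \<in> orbit_fibre (D, m, n)"
  shows "orbit_term s1 s2 w X =
    1 / of_int \<bar>D\<bar> powr w * (1 / (of_nat m powr s1 * of_nat n powr s2))"
proof -
  obtain A where X: "X = cube_orbit A" and A: "A \<in> cubes_with D m n"
    using assms by (auto simp: orbit_fibre_def)
  have "cube_eqv A (SOME B. B \<in> X)" using some_in_cube_orbit X by blast
  from cube_eqv_invariants[OF this] show ?thesis
    using A unfolding orbit_term_def Let_def cubes_with_def by simp
qed

text \<open>The discriminant and the absolute values of \<open>m\<close> and \<open>n\<close> are
  constant on orbits, so the fibres partition the semistable orbits.\<close>

lemma bij_betw_orbit_fibre: "bij_betw snd (Sigma triples orbit_fibre) ss_orbits"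
proof (rule bij_betw_imageI)
  show "inj_on snd (Sigma triples orbit_fibre)"
  proof (rule inj_onI)
    fix p q assume p: "p \<in> Sigma triples orbit_fibre" and q: "q \<in> Sigma triples orbit_fibre"
      and "snd p = snd q"
    then obtain D m n D' m' n' X where *: "p = ((D, m, n), X)" "q = ((D', m', n'), X)"
      by (metis prod.exhaust snd_conv)
    obtain A B where A: "A \<in> cubes_with D m n" "X = cube_orbit A"
      and B: "B \<in> cubes_with D' m' n'" "X = cube_orbit B"
      using p q unfolding * by (auto simp: orbit_fibre_def)
    then have "cube_eqv A B" using cube_orbit_eq_iff by blast
    from cube_eqv_invariants[OF this] show "p = q" using A B by (simp add: * cubes_with_def)
  qed
  have "cube_orbit A \<in> snd ` Sigma triples orbit_fibre" if "A \<in> ss_cubes" for A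
    by (rule image_eqI[of _ _ "((cube_disc A, nat \<bar>cube_m A\<bar>, nat \<bar>cube_n A\<bar>), cube_orbit A)"])
       (use that in \<open>auto simp: orbit_fibre_def cubes_with_def ss_cubes_def\<close>)
  moreover have "cube_orbit A \<in> ss_orbits" if "A \<in> cubes_with D m n" "(D, m, n) \<in> triples" for A D m n
    unfolding ss_orbits_eq using that by (auto simp: cubes_with_def ss_cubes_def)
  ultimately show "snd ` Sigma triples orbit_fibre = ss_orbits"
    by (auto simp: ss_orbits_eq orbit_fibre_def)
qed

text \<open>The summand is constant on a fibre, so each sum is that constant times the number
  \<open>B_coeff D m n\<close> of orbits.\<close>

lemma sum_orbit_fibre:
  assumes "(D, m, n) \<in> triples"
  shows "finite (orbit_fibre (D, m, n))"
    and "(\<Sum>\<^sub>\<infinity>X\<in>orbit_fibre (D, m, n). orbit_term s1 s2 w X) =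
      1 / of_int \<bar>D\<bar> powr w * (of_nat (B_coeff D m n) / (of_nat m powr s1 * of_nat n powr s2))"
    and "(\<Sum>\<^sub>\<infinity>X\<in>orbit_fibre (D, m, n). norm (orbit_term s1 s2 w X)) =
      real (B_coeff D m n) * (real_of_int \<bar>D\<bar> powr - Re w * (real m powr - Re s1 * real n powr - Re s2))"
proof -
  have pos: "m > 0" "n > 0" using assms by auto
  note c = card_orbits_with[OF pos, of D]
  show fin: "finite (orbit_fibre (D, m, n))" using c by (simp add: orbit_fibre_def)
  have card: "card (orbit_fibre (D, m, n)) = B_coeff D m n" using c by (simp add: orbit_fibre_def)
  show "(\<Sum>\<^sub>\<infinity>X\<in>orbit_fibre (D, m, n). orbit_term s1 s2 w X) =
      1 / of_int \<bar>D\<bar> powr w * (of_nat (B_coeff D m n) / (of_nat m powr s1 * of_nat n powr s2))"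
    using fin by (simp add: orbit_term_fibre card)
  have "norm (of_int \<bar>D\<bar> powr w :: complex) = real_of_int \<bar>D\<bar> powr Re w"
    using norm_powr_real_powr[of "of_int \<bar>D\<bar>" w] by simp
  moreover have "norm (of_nat k powr s :: complex) = real k powr Re s" for k s
    using norm_powr_real_powr[of "of_nat k" s] by simp
  ultimately show "(\<Sum>\<^sub>\<infinity>X\<in>orbit_fibre (D, m, n). norm (orbit_term s1 s2 w X)) =
      real (B_coeff D m n) * (real_of_int \<bar>D\<bar> powr - Re w * (real m powr - Re s1 * real n powr - Re s2))"
    using fin by (simp add: orbit_term_fibre card norm_mult norm_divide powr_minus divide_simps)
qed

theorem theorem1p1:
  fixes s1 s2 w :: complex
  shows
    "(Re s1 > 1 \<and> Re s2 > 1 \<and> Re w > 1 \<longrightarrow> orbit_term s1 s2 w summable_on ss_orbits) \<and>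
     (orbit_term s1 s2 w summable_on ss_orbits \<longrightarrow>
        (\<forall>D. D \<noteq> 0 \<longrightarrow>
           (\<lambda>(m, n). of_nat (B_coeff D m n) / (of_nat m powr s1 * of_nat n powr s2))
             summable_on ({0<..} \<times> {0<..})) \<and>
        (\<lambda>D. 1 / of_int \<bar>D\<bar> powr w *
           (\<Sum>\<^sub>\<infinity>(m, n)\<in>{0<..} \<times> {0<..}.
              of_nat (B_coeff D m n) / (of_nat m powr s1 * of_nat n powr s2)))
          summable_on {D. D \<noteq> 0} \<and>
        Z_Shintani s1 s2 w =
          (\<Sum>\<^sub>\<infinity>D\<in>{D. D \<noteq> 0}. 1 / of_int \<bar>D\<bar> powr w *
             (\<Sum>\<^sub>\<infinity>(m, n)\<in>{0<..} \<times> {0<..}.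
                of_nat (B_coeff D m n) / (of_nat m powr s1 * of_nat n powr s2))))"
proof (intro conjI impI)
  let ?f = "orbit_term s1 s2 w"
  assume s: "Re s1 > 1 \<and> Re s2 > 1 \<and> Re w > 1"
  \<comment> \<open>Absolute convergence is tested on the orbits grouped by fibres, where the sums
    of norms are the real series of \<open>summable_on_B_coeff\<close>.\<close>
  have "(\<lambda>p. norm (?f (snd p))) summable_on Sigma triples orbit_fibre"
  proof (subst Infinite_Sum.abs_summable_on_Sigma_iff, intro conjI ballI)
    fix x assume "x \<in> triples"
    then show "(\<lambda>X. norm (?f (snd (x, X)))) summable_on orbit_fibre x"
      using sum_orbit_fibre(1) by (cases x) auto
  next
    let ?g = "\<lambda>(D, m, n). real (B_coeff D m n) *
      (real_of_int \<bar>D\<bar> powr - Re w * (real m powr - Re s1 * real n powr - Re s2))"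
    have eq: "(\<Sum>\<^sub>\<infinity>X\<in>orbit_fibre x. norm (?f (snd (x, X)))) = ?g x" if "x \<in> triples" for x
      using that sum_orbit_fibre(3) by (cases x) (simp only: prod.case snd_conv)
    have "?g summable_on triples"
      by (rule summable_on_B_coeff) (use s in auto)
    moreover have "(\<lambda>x. \<Sum>\<^sub>\<infinity>X\<in>orbit_fibre x. norm (?f (snd (x, X)))) summable_on triples
        \<longleftrightarrow> ?g summable_on triples"
      by (rule summable_on_cong) (rule eq)
    ultimately have "(\<lambda>x. \<Sum>\<^sub>\<infinity>X\<in>orbit_fibre x. norm (?f (snd (x, X)))) summable_on triples"
      by (rule iffD2[rotated])
    then show "(\<lambda>x. norm (\<Sum>\<^sub>\<infinity>X\<in>orbit_fibre x. norm (?f (snd (x, X))))) summable_on triples"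
      by (rule summable_on_iff_abs_summable_on_real[THEN iffD1])
  qed
  then have "(\<lambda>p. ?f (snd p)) summable_on Sigma triples orbit_fibre"
    by (rule abs_summable_summable)
  then show "?f summable_on ss_orbits"
    by (simp only: summable_on_reindex_bij_betw[OF bij_betw_orbit_fibre])
next
  let ?f = "orbit_term s1 s2 w"
  let ?b = "\<lambda>D m n. of_nat (B_coeff D m n) / (of_nat m powr s1 * of_nat n powr s2) :: complex"
  let ?c = "\<lambda>D. 1 / of_int \<bar>D\<bar> powr w :: complex"
  let ?P = "{0<..} \<times> {0<..} :: (nat \<times> nat) set"
  assume "?f summable_on ss_orbits"
  then have sum_pairs: "(\<lambda>p. ?f (snd p)) summable_on Sigma triples orbit_fibre"
    by (simp only: summable_on_reindex_bij_betw[OF bij_betw_orbit_fibre])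
  have fibre: "(\<Sum>\<^sub>\<infinity>X\<in>orbit_fibre x. ?f X) = (case x of (D, m, n) \<Rightarrow> ?c D * ?b D m n)"
    if "x \<in> triples" for x
    using that sum_orbit_fibre(2) by (cases x) auto
  have "(\<lambda>x. \<Sum>\<^sub>\<infinity>X\<in>orbit_fibre x. ?f X) summable_on triples"
    by (rule summable_on_Sigma_banach) (use sum_pairs in \<open>simp add: case_prod_unfold\<close>)
  then have sum_triples: "(\<lambda>(D, p). case p of (m, n) \<Rightarrow> ?c D * ?b D m n) summable_on {D. D \<noteq> 0} \<times> ?P"
    by (rule summable_on_cong[THEN iffD1, rotated]) (auto simp: fibre)
  have inner: "(\<lambda>(m, n). ?b D m n) summable_on ?P" if "D \<noteq> 0" for D
  proof -
    have "(\<lambda>(m, n). ?c D * ?b D m n) summable_on ?P"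
      using summable_on_SigmaD1[OF sum_triples, of D] that by simp
    then have "(\<lambda>p. ?c D * (case p of (m, n) \<Rightarrow> ?b D m n)) summable_on ?P"
      by (simp add: case_prod_unfold)
    \<comment> \<open>The factor in front is nonzero for \<open>D \<noteq> 0\<close>, so it can be
      cancelled.\<close>
    then show ?thesis by (subst (asm) summable_on_cmult_right') (use that in auto)
  qed
  then show "\<forall>D. D \<noteq> 0 \<longrightarrow> (\<lambda>(m, n). ?b D m n) summable_on ?P"
    by (intro allI impI)
  \<comment> \<open>At \<open>D = 0\<close> both sides vanish, since \<open>0 powr w = 0\<close> and
    \<open>1 / 0 = 0\<close>.\<close>
  have outer: "(\<Sum>\<^sub>\<infinity>(m, n)\<in>?P. ?c D * ?b D m n) = ?c D * (\<Sum>\<^sub>\<infinity>(m, n)\<in>?P. ?b D m n)" for D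
    by (simp only: infsum_cmult_right'[symmetric] case_prod_unfold)
  show "(\<lambda>D. ?c D * (\<Sum>\<^sub>\<infinity>(m, n)\<in>?P. ?b D m n)) summable_on {D. D \<noteq> 0}"
    using summable_on_Sigma_banach[OF sum_triples] by (simp only: outer)
  have "Z_Shintani s1 s2 w = (\<Sum>\<^sub>\<infinity>p\<in>Sigma triples orbit_fibre. ?f (snd p))"
    unfolding Z_Shintani_def by (rule infsum_reindex_bij_betw[OF bij_betw_orbit_fibre, symmetric])
  also have "\<dots> = (\<Sum>\<^sub>\<infinity>x\<in>triples. \<Sum>\<^sub>\<infinity>X\<in>orbit_fibre x. ?f X)"
    using infsum_Sigma_banach[OF sum_pairs] by simp
  also have "\<dots> = (\<Sum>\<^sub>\<infinity>(D, p)\<in>triples. case p of (m, n) \<Rightarrow> ?c D * ?b D m n)"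
    by (rule infsum_cong) (auto simp: fibre)
  also have "\<dots> = (\<Sum>\<^sub>\<infinity>D\<in>{D. D \<noteq> 0}. \<Sum>\<^sub>\<infinity>(m, n)\<in>?P. ?c D * ?b D m n)"
    using infsum_Sigma_banach[OF sum_triples] by simp
  finally show "Z_Shintani s1 s2 w = (\<Sum>\<^sub>\<infinity>D\<in>{D. D \<noteq> 0}. ?c D * (\<Sum>\<^sub>\<infinity>(m, n)\<in>?P. ?b D m n))"
    by (simp only: outer)
qed

end
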